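(* Let $G$ be a locally compact group, let $d\in\mathbb{N}$ and let $f\in\mathcal{P}(\mathbb{S}^d,G)$. Then the partial derivative $\frac{\partial^n f(x,u)}{\partial x^n}$ exists and is continuous on $]-1,1[\,\times G$ for every integer $n\ge 0$ with $n\le[(d-1)/2]$.
   Context: $\mathbb{N}=\{1,2,\ldots\}$; $[a]$ denotes the largest integer $\le a$; $]-1,1[$ is the open interval. $\mathbb{S}^d$ is the unit sphere of $\mathbb{R}^{d+1}$ and $\xi\cdot\eta$ is the Euclidean scalar product. $\mathcal{P}(\mathbb{S}^d,G)$ is the set of continuous functions $f:[-1,1]\times G\to\mathbb{C}$ such that for all $m\in\mathbb{N}$ and all $(\xi_1,u_1),\ldots,(\xi_m,u_m)\in\mathbb{S}^d\times G$ the matrix $[f(\xi_k\cdot\xi_l,u_k^{-1}u_l)]_{k,l=1}^m$ is positive semidefinite, i.e. $\sum_{k,l=1}^m f(\xi_k\cdot\xi_l,u_k^{-1}u_l)a_k\overline{a_l}\ge 0$ for all $(a_1,\ldots,a_m)\in\mathbb{C}^m$. *)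

theory Defs
  imports "HOL-Analysis.Analysis"
begin

text \<open>
  The class \<open>P(S^d, G)\<close>.  The type \<open>'n\<close> indexes the coordinates of the ambient space, so
  \<open>S^d\<close> is the unit sphere of \<^typ>\<open>real ^ 'n\<close> with \<open>CARD('n) = d + 1\<close>.

  Groups are written additively, since the distribution provides topological groups only as the
  class \<^class>\<open>topological_group_add\<close>.  This class does not assume commutativity: the group element
  \<open>u\<^sup>-\<^sup>1 v\<close> is \<open>- u + v\<close>, and the order of the summands matters.

  Functions on \<open>[-1,1] \<times> G\<close> are total functions on \<^typ>\<open>real \<times> 'g\<close>; their values for a first
  argument outside \<open>[-1,1]\<close> are irrelevant.  Membership in \<open>\<real>\<^sub>\<ge>\<^sub>0\<close> says that the complex sum
  is real and nonnegative.
\<close>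

definition pd_sphere_group ::
    "'n::finite itself \<Rightarrow> (real \<times> 'g::topological_group_add \<Rightarrow> complex) set" where
  "pd_sphere_group _ = {f.
     continuous_on ({-1..1} \<times> UNIV) f \<and>
     (\<forall>(m::nat) (\<xi> :: nat \<Rightarrow> real ^ 'n) (u :: nat \<Rightarrow> 'g) (a :: nat \<Rightarrow> complex).
        m \<ge> 1 \<longrightarrow> (\<forall>k\<in>{1..m}. \<xi> k \<in> sphere 0 1) \<longrightarrow>
        (\<Sum>k=1..m. \<Sum>l=1..m. f (\<xi> k \<bullet> \<xi> l, - u k + u l) * a k * cnj (a l)) \<in> \<real>\<^sub>\<ge>\<^sub>0)}"

definition partial_x :: "nat \<Rightarrow> (real \<times> 'g \<Rightarrow> complex) \<Rightarrow> real \<times> 'g \<Rightarrow> complex" where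
  "partial_x n f = ((\<lambda>h (x, u). vector_derivative (\<lambda>t. h (t, u)) (at x)) ^^ n) f"

text \<open>
  Since \<^const>\<open>vector_derivative\<close> is total, \<^const>\<open>partial_x\<close> is meaningful only together with
  the following predicate: the \<open>n\<close>-th partial derivative exists at every point of \<open>]-1,1[ \<times> G\<close>.
\<close>

definition partial_x_exists :: "nat \<Rightarrow> (real \<times> 'g \<Rightarrow> complex) \<Rightarrow> bool" where
  "partial_x_exists n f \<longleftrightarrow>
     (\<forall>k<n. \<forall>x\<in>{-1<..<1}. \<forall>u. (\<lambda>t. partial_x k f (t, u)) differentiable (at x))"

end

theory Submission
  imports Defs "HOL-Computational_Algebra.Polynomial"
begin

text \<open>
  The function is expanded as \<open>f(x,u) = \<Sum>\<^sub>k a\<^sub>k(u) c\<^sub>k(d,x)\<close> in normalised Gegenbauer polynomials.  For a positive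
  definite \<open>F\<close> on \<open>S\<^sup>d\<close> the coefficients are nonnegative: by the product formula, the convolution with \<open>F\<close>
  is diagonal on the \<open>c\<^sub>k\<close>, and averaging over the equator reduces positivity to \<open>S\<^bsup>d - 1\<^esup>\<close>.  Testing
  against \<open>(1 + x)\<^sup>m\<close> shows that they are summable.  Polarisation in the group variable gives
  \<open>\<bar>a\<^sub>k(u)\<bar> \<le> 2 a\<^sub>k(0)\<close>, so the series converges uniformly on \<open>[-1,1] \<times> G\<close>.  Finally
  \<open>(1 - x\<^sup>2) c\<^sub>k(d + 2,x)' = d (x c\<^sub>k(d + 2,x) - c\<^sub>k\<^sub>+\<^sub>1(d,x))\<close> together with \<open>\<bar>c\<^sub>k\<bar> \<le> 1\<close> bounds the \<open>n\<close>-th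
  derivatives of \<open>c\<^sub>k(d,x)\<close> on compact subsets of \<open>]-1,1[\<close>, uniformly in \<open>k\<close>, as long as \<open>2 n + 1 \<le> d\<close>.
\<close>

text \<open>The exponent is a count of dimensions. Each derivative of a Gegenbauer polynomial costs
  two dimensions, and the plain bound by \<open>1\<close> is available from dimension one on; this
  makes \<open>2 * n + 1 \<le> d\<close>, which is the floor condition. Each derivative also costs a
  factor \<open>1 / (1 - x\<^sup>2)\<close>, hence the compact subintervals. Joint continuity needs
  one summable sequence that dominates the coefficients for all \<open>u\<close> at once; the
  coefficients at the neutral element provide it. Spherical integrals occur only for zonal
  functions, so they are weighted integrals over an angle, and rotating two coordinates replaces the
  rotation group. The product formula serves twice: it yields the bound by \<open>1\<close>, and it
  makes slice averages act diagonally, which links positivity in dimension \<open>e + 1\<close> to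
  that in dimension \<open>e\<close>.\<close>

subsection \<open>Integration of zonal functions\<close>

text \<open>
  Up to a constant, \<open>zint e g\<close> is the integral of \<open>g (\<xi> \<bullet> \<eta>)\<close> over \<open>\<eta> \<in> S\<^sup>e\<close>.  The case \<open>e = 0\<close> is the
  counting measure on \<open>S\<^sup>0 = {1, -1}\<close>, for which the density \<open>sin t ^ (e - 1)\<close> makes no sense.
\<close>

definition zint :: "nat \<Rightarrow> (real \<Rightarrow> real) \<Rightarrow> real" where
  "zint e g = (case e of 0 \<Rightarrow> g 1 + g (-1)
     | Suc i \<Rightarrow> integral {0..pi} (\<lambda>t. g (cos t) * sin t ^ i))"

lemma zint_0: "zint 0 g = g 1 + g (-1)"
  and zint_Suc: "zint (Suc i) g = integral {0..pi} (\<lambda>t. g (cos t) * sin t ^ i)"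
  by (simp_all add: zint_def)

lemma continuous_on_zint_integrand:
  assumes "continuous_on {-1..1} (g :: real \<Rightarrow> real)"
  shows "continuous_on {0..pi} (\<lambda>t. g (cos t) * sin t ^ i)"
  by (intro continuous_intros continuous_on_compose2[OF assms]) auto

lemma zint_integrable:
  assumes "continuous_on {-1..1} (g :: real \<Rightarrow> real)"
  shows "(\<lambda>t. g (cos t) * sin t ^ i) integrable_on {0..pi}"
  by (intro integrable_continuous_real continuous_on_zint_integrand assms)

lemma zint_cong:
  assumes "\<And>x. x \<in> {-1..1} \<Longrightarrow> g x = h x"
  shows "zint e g = zint e h"
  using assms by (auto simp: zint_def split: nat.split intro!: integral_cong)

lemma zint_zero [simp]: "zint e (\<lambda>x. 0) = 0"
  by (simp add: zint_def split: nat.split)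

lemma zint_add:
  assumes "continuous_on {-1..1} g" "continuous_on {-1..1} h"
  shows "zint e (\<lambda>x. g x + h x) = zint e g + zint e h"
proof (cases e)
  case (Suc i)
  show ?thesis
    unfolding Suc zint_Suc distrib_right by (intro integral_add zint_integrable assms)
qed (simp add: zint_0)

lemma zint_cmult: "zint e (\<lambda>x. c * g x) = c * zint e g"
  by (cases e) (simp_all add: zint_0 zint_Suc distrib_left mult.assoc)

lemma zint_minus: "zint e (\<lambda>x. - g x) = - zint e g"
  using zint_cmult[of e "-1" g] by simp

lemma zint_diff:
  assumes "continuous_on {-1..1} g" "continuous_on {-1..1} h"
  shows "zint e (\<lambda>x. g x - h x) = zint e g - zint e h"
  using zint_add[OF assms(1) continuous_on_minus[OF assms(2)], of e] by (simp add: zint_minus)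

lemma zint_sum:
  assumes "finite I" "\<And>i. i \<in> I \<Longrightarrow> continuous_on {-1..1} (g i)"
  shows "zint e (\<lambda>x. \<Sum>i\<in>I. g i x) = (\<Sum>i\<in>I. zint e (g i))"
  using assms by (induction I rule: finite_induct) (simp_all add: zint_add continuous_on_sum)

lemma zint_nonneg:
  assumes "continuous_on {-1..1} g" "\<And>x. x \<in> {-1..1} \<Longrightarrow> 0 \<le> g x"
  shows "0 \<le> zint e g"
  using assms
  by (auto simp: zint_def split: nat.split intro!: integral_nonneg zint_integrable
      mult_nonneg_nonneg zero_le_power sin_ge_zero)

lemma zint_mono:
  assumes "continuous_on {-1..1} g" "continuous_on {-1..1} h"
    and "\<And>x. x \<in> {-1..1} \<Longrightarrow> g x \<le> h x"
  shows "zint e g \<le> zint e h"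
  using zint_nonneg[of "\<lambda>x. h x - g x" e] assms by (simp add: zint_diff continuous_intros)

lemma zint_const: "zint e (\<lambda>x. c) = c * zint e (\<lambda>x. 1)"
  using zint_cmult[of e c "\<lambda>x. 1"] by simp

lemma zint_diff_bound:
  assumes "continuous_on {-1..1} g" "continuous_on {-1..1} h"
    and "\<And>x. x \<in> {-1..1} \<Longrightarrow> \<bar>g x - h x\<bar> \<le> B"
  shows "\<bar>zint e g - zint e h\<bar> \<le> B * zint e (\<lambda>x. 1)"
proof -
  have "zint e (\<lambda>x. g x - h x) \<le> zint e (\<lambda>x. B)" "zint e (\<lambda>x. h x - g x) \<le> zint e (\<lambda>x. B)"
    using assms by (intro zint_mono continuous_intros; fastforce simp: abs_le_iff)+
  then show ?thesis
    using assms by (simp add: zint_diff zint_const[of e B])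
qed

lemma zint_bound:
  assumes "continuous_on {-1..1} g" "\<And>x. x \<in> {-1..1} \<Longrightarrow> \<bar>g x\<bar> \<le> B"
  shows "\<bar>zint e g\<bar> \<le> B * zint e (\<lambda>x. 1)"
  using zint_diff_bound[of g "\<lambda>x. 0" B e] assms by simp

text \<open>The weight \<open>sin t ^ e\<close> may vanish at both ends, so only interior points of
  the interval are reached.\<close>

lemma zint_eq_0D:
  assumes "continuous_on {-1..1} g" "\<And>x. x \<in> {-1..1} \<Longrightarrow> 0 \<le> g x"
    and "zint (Suc e) g = 0" "x \<in> {-1<..<1}"
  shows "g x = 0"
proof -
  let ?h = "\<lambda>t. g (cos t) * sin t ^ e"
  have "(?h has_integral 0) (cbox 0 pi)"
    using integrable_integral[OF zint_integrable[OF assms(1), of e]] assms(3) by (simp add: zint_Suc)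
  moreover have "0 \<le> ?h t" if "t \<in> box 0 pi" for t
    using that assms(2)[of "cos t"] by (simp add: sin_ge_zero)
  moreover have "arccos x \<in> cbox 0 pi"
    using assms(4) by (simp add: arccos_lbound arccos_ubound)
  moreover have "continuous_on (cbox 0 pi) ?h"
    using continuous_on_zint_integrand[OF assms(1)] by simp
  ultimately have "?h (arccos x) = 0"
    by (intro has_integral_0_cbox_imp_0[where f="?h"]) (use pi_gt_zero in \<open>auto simp del: pi_gt_zero\<close>)
  moreover have "sin (arccos x) \<noteq> 0"
    using assms(4) by (intro sin_arccos_nonzero) auto
  ultimately show ?thesis using assms(4) by simp
qed

lemma zint_one_pos: "0 < zint e (\<lambda>x. 1)"
proof (cases e)
  case (Suc i)
  have "zint e (\<lambda>x. 1) \<noteq> 0"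
    using zint_eq_0D[of "\<lambda>x. 1" i 0] Suc by auto
  then show ?thesis using zint_nonneg[of "\<lambda>x. 1" e] by (simp add: less_le)
qed (simp add: zint_0)

lemma continuous_on_zint:
  fixes g :: "'a::topological_space \<Rightarrow> real \<Rightarrow> real"
  assumes "continuous_on (U \<times> {-1..1}) (\<lambda>(x, r). g x r)"
  shows "continuous_on U (\<lambda>x. zint e (g x))"
proof (cases e)
  case 0
  have "continuous_on U (\<lambda>x. g x r)" if "r \<in> {-1..1}" for r
  proof -
    have "continuous_on U (\<lambda>x. (x, r))" by (intro continuous_intros)
    moreover have "(\<lambda>x. (x, r)) ` U \<subseteq> U \<times> {-1..1}" using that by auto
    ultimately have "continuous_on U (\<lambda>x. case (x, r) of (x, r) \<Rightarrow> g x r)"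
      by (rule continuous_on_compose2[OF assms])
    then show ?thesis by simp
  qed
  then show ?thesis using 0 by (simp add: zint_0 continuous_on_add)
next
  case (Suc i)
  have "continuous_on (U \<times> {0..pi}) (\<lambda>p. g (fst p) (cos (snd p)))"
  proof -
    have "continuous_on (U \<times> {0..pi}) (\<lambda>p. cos (snd p))"
      by (rule continuous_on_compose2[of UNIV cos]) (auto intro!: continuous_intros)
    then have "continuous_on (U \<times> {0..pi}) (\<lambda>p. (fst p, cos (snd p)))"
      by (intro continuous_intros)
    moreover have "(\<lambda>p. (fst p, cos (snd p))) ` (U \<times> {0..pi}) \<subseteq> U \<times> {-1..1}" by auto
    ultimately have "continuous_on (U \<times> {0..pi}) (\<lambda>p. case (fst p, cos (snd p)) of (x, r) \<Rightarrow> g x r)"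
      by (rule continuous_on_compose2[OF assms])
    then show ?thesis by simp
  qed
  moreover have "continuous_on (U \<times> {0..pi}) (\<lambda>p. sin (snd p))"
    by (rule continuous_on_compose2[of UNIV sin]) (auto intro!: continuous_intros)
  ultimately have "continuous_on (U \<times> cbox 0 pi) (\<lambda>(x, t). g x (cos t) * sin t ^ i)"
    by (auto simp: case_prod_beta intro!: continuous_intros)
  then have "continuous_on U (\<lambda>x. integral (cbox 0 pi) (\<lambda>t. g x (cos t) * sin t ^ i))"
    by (rule integral_continuous_on_param)
  then show ?thesis by (simp add: Suc zint_Suc)
qed

text \<open>The integrations by parts below all take this form: a primitive in \<open>sin\<close>
  and \<open>cos\<close> whose boundary values agree.\<close>

lemma integral_derivative_vanishing:
  fixes F :: "real \<Rightarrow> real"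
  assumes "\<And>t. (F has_real_derivative F' t) (at t)" "F pi = F 0"
  shows "integral {0..pi} F' = 0"
proof -
  have "(F' has_integral F pi - F 0) {0..pi}"
    using assms(1) by (intro fundamental_theorem_of_calculus)
      (auto simp flip: has_real_derivative_iff_has_vector_derivative
        intro: DERIV_subset)
  then show ?thesis using assms(2) by (simp add: integral_unique)
qed

text \<open>Integration by parts with the primitive \<open>cos t ^ (q + 1) * sin t ^ e\<close>,
  which vanishes at both ends for positive \<open>e\<close>. For \<open>e = 0\<close> both sides are
  \<open>(q + 1) * (1 + (-1) ^ q)\<close>.\<close>

lemma zint_moment_rec:
  "(real q + 1 + real e) * zint e (\<lambda>x. x ^ (q + 2)) = (real q + 1) * zint e (\<lambda>x. x ^ q)"
proof (cases e)
  case (Suc i)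
  let ?F = "\<lambda>t. cos t ^ Suc q * sin t ^ Suc i :: real"
  let ?F' = "\<lambda>t. (real q + 1 + real e) * (cos t ^ (q + 2) * sin t ^ i) - (real q + 1) * (cos t ^ q * sin t ^ i)"
  have "(?F has_real_derivative ?F' t) (at t)" for t :: real
  proof -
    have *: "sin t ^ (i + 2) = sin t ^ i - sin t ^ i * cos t ^ 2"
      by (simp only: power_add sin_squared_eq right_diff_distrib mult_1_right)
    have "(?F has_real_derivative
        (real i + 1) * (cos t ^ (q + 2) * sin t ^ i) - (real q + 1) * (cos t ^ q * sin t ^ (i + 2))) (at t)"
      by (rule DERIV_cong[OF DERIV_mult[OF DERIV_power_Suc[OF DERIV_cos] DERIV_power_Suc[OF DERIV_sin]]])
        (simp add: algebra_simps)
    then show ?thesis by (rule DERIV_cong) (subst *, simp add: Suc algebra_simps power_add power2_eq_square)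
  qed
  then have "integral {0..pi} ?F' = 0"
    by (rule integral_derivative_vanishing) simp
  moreover have "(\<lambda>t. (real q + 1 + real e) * (cos t ^ (q + 2) * sin t ^ i)) integrable_on {0..pi}"
    "(\<lambda>t. (real q + 1) * (cos t ^ q * sin t ^ i)) integrable_on {0..pi}"
    by (intro integrable_continuous_real continuous_intros)+
  ultimately show ?thesis
    by (simp add: Suc zint_Suc integral_diff)
qed (simp add: zint_0)

lemma zint_odd_moment: "odd q \<Longrightarrow> zint e (\<lambda>x. x ^ q) = 0"
proof (induction q rule: nat_less_induct)
  case (1 q)
  show ?case
  proof (cases "q = 1")
    case True
    show ?thesis
    proof (cases e)
      case (Suc i)
      have "integral {0..pi} (\<lambda>t. (real i + 1) * (cos t * sin t ^ i)) = 0"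
      proof (rule integral_derivative_vanishing[where F="\<lambda>t. sin t ^ Suc i"])
        show "((\<lambda>t. sin t ^ Suc i) has_real_derivative (real i + 1) * (cos t * sin t ^ i)) (at t)" for t :: real
          using DERIV_power_Suc[OF DERIV_sin[of t], of i] by (simp add: add.commute)
      qed simp
      then show ?thesis using True by (simp add: Suc zint_Suc)
    qed (simp add: zint_0 True)
  next
    case False
    then obtain p where p: "q = p + 2" "odd p"
      using \<open>odd q\<close> that[of "q - 2"] by (cases q; cases "q - 1") auto
    then have "zint e (\<lambda>x. x ^ p) = 0" using 1 by simp
    then show ?thesis using zint_moment_rec[of p e] p(1) by simp
  qed
qed

subsection \<open>Gegenbauer polynomials\<close>

text \<open>
  \<open>geg k d\<close> is the Gegenbauer polynomial of degree \<open>k\<close> for \<open>S\<^sup>d\<close> (parameter \<open>\<lambda> = (d - 1) / 2\<close>), normalised to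
  have value \<open>1\<close> at \<open>1\<close>; it is \<open>c\<^sub>k(d, x)\<close> in the literature on Schoenberg coefficients.  The recursion is the
  weighted derivative \<open>d (1 - x\<^sup>2)\<^bsup>(d - 2) / 2\<^esup> c\<^sub>k\<^sub>+\<^sub>1(d, x) = - ((1 - x\<^sup>2)\<^bsup>d / 2\<^esup> c\<^sub>k(d + 2, x))'\<close>.
\<close>

fun geg :: "nat \<Rightarrow> nat \<Rightarrow> real poly" where
  "geg 0 d = 1"
| "geg (Suc k) d = [:0, 1:] * geg k (d + 2) - smult (1 / real d) ([:1, 0, -1:] * pderiv (geg k (d + 2)))"

declare geg.simps(2) [simp del]

text \<open>The derivative term of the recursion carries the factor \<open>1 - x\<^sup>2\<close>,
  which vanishes at \<open>1\<close>.\<close>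

lemma poly_geg_1 [simp]: "poly (geg k d) 1 = 1"
  by (induction k d rule: geg.induct) (simp_all add: geg.simps(2))

lemma degree_geg: "degree (geg k d) \<le> k"
proof (induction k d rule: geg.induct)
  case (2 k d)
  have "degree ([:0, 1:] * geg k (d + 2)) \<le> Suc k"
    using degree_mult_le[of "[:0, 1:]" "geg k (d + 2)"] 2 by simp
  moreover have "degree ([:1, 0, -1:] * pderiv (geg k (d + 2))) \<le> Suc k"
  proof (cases "pderiv (geg k (d + 2)) = 0")
    case False
    then have "degree (geg k (d + 2)) \<noteq> 0" by (simp add: pderiv_eq_0_iff)
    then show ?thesis
      using degree_mult_le[of "[:1, 0, -1:]" "pderiv (geg k (d + 2))"] 2
      by (simp add: degree_pderiv del: mult_pCons_left)
  qed simp
  ultimately show ?case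
    unfolding geg.simps by (intro degree_diff_le order.trans[OF degree_smult_le])
qed simp

text \<open>The recursion multiplies the leading coefficient by \<open>1 + k / d\<close>. A nonzero
  coefficient at \<open>k\<close> is what allows the triangular elimination in
  \<open>poly_geg_expansion\<close>.\<close>

lemma coeff_geg_pos:
  assumes "d > 0"
  shows "coeff (geg k d) k > 0"
  using assms
proof (induction k d rule: geg.induct)
  case (2 k d)
  then have "coeff (geg k (d + 2)) k > 0" by simp
  moreover have "coeff (geg k (d + 2)) (Suc (Suc k)) = 0"
    using degree_geg[of k "d + 2"] by (intro coeff_eq_0) simp
  moreover have "coeff (geg (Suc k) d) (Suc k) = coeff (geg k (d + 2)) k * (1 + real k / real d)
      - coeff (geg k (d + 2)) (Suc (Suc k)) * (real k + 2) / real d"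
    unfolding geg.simps using 2(2) by (cases k) (simp_all add: coeff_pCons coeff_pderiv add_divide_distrib diff_divide_distrib algebra_simps)
  ultimately show ?case by simp (simp add: add_pos_nonneg)
qed simp

section \<open>Orthogonality and finite Gegenbauer expansions\<close>

definition pint :: "nat \<Rightarrow> real poly \<Rightarrow> real" where
  "pint d p = zint d (\<lambda>x. poly p x)"

lemma pint_add: "pint d (p + q) = pint d p + pint d q"
  by (simp add: pint_def zint_add continuous_intros)

lemma pint_smult: "pint d (smult c p) = c * pint d p"
  by (simp add: pint_def zint_cmult)

lemma pint_0 [simp]: "pint d 0 = 0"
  by (simp add: pint_def)

lemma pint_nonneg: "(\<And>x. x \<in> {-1..1} \<Longrightarrow> 0 \<le> poly p x) \<Longrightarrow> 0 \<le> pint d p"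
  unfolding pint_def by (rule zint_nonneg) (auto intro!: continuous_intros)

lemma pint_sum:
  "finite I \<Longrightarrow> pint d (\<Sum>i\<in>I. p i) = (\<Sum>i\<in>I. pint d (p i))"
  by (induction I rule: finite_induct) (simp_all add: pint_add)

text \<open>Integration by parts with the weighted-derivative form of the recursion: a derivative
  moves to \<open>p\<close> while the dimension grows by two. Orthogonality, positivity and the
  concentration of \<open>(1 + x) ^ m\<close> all rest on this identity.\<close>

lemma pint_mult_geg_Suc:
  assumes "d > 0"
  shows "pint d (p * geg (Suc k) d) = pint (d + 2) (pderiv p * geg k (d + 2)) / real d"
proof -
  from assms obtain e where d: "d = Suc e" by (cases d) auto
  define c where "c = geg k (d + 2)"
  let ?F = "\<lambda>t. poly (p * c) (cos t) * sin t ^ Suc e"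
  let ?G = "\<lambda>t. poly (pderiv p * c) (cos t) * sin t ^ Suc (Suc e)"
  let ?H = "\<lambda>t. poly (p * geg (Suc k) d) (cos t) * sin t ^ e"
  have "(?F has_real_derivative real d * ?H t - ?G t) (at t)" for t
  proof -
    have D: "((\<lambda>t. poly (p * c) (cos t)) has_real_derivative poly (pderiv (p * c)) (cos t) * - sin t) (at t)"
      by (rule DERIV_chain2[OF poly_DERIV DERIV_cos])
    have "real d * poly (geg (Suc k) d) y = real d * (y * poly c y) - (1 - y * y) * poly (pderiv c) y" for y
      using assms by (simp add: c_def geg.simps(2) field_simps)
    moreover have "1 - cos t * cos t = sin t ^ 2"
      using sin_squared_eq[of t] by (simp add: power2_eq_square)
    ultimately have *: "real d * poly (geg (Suc k) d) (cos t)
        = real d * (cos t * poly c (cos t)) - sin t ^ 2 * poly (pderiv c) (cos t)"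
      by metis
    have "real d * ?H t = poly p (cos t) * (real d * (cos t * poly c (cos t)) -
        sin t ^ 2 * poly (pderiv c) (cos t)) * sin t ^ e"
      unfolding *[symmetric] poly_mult by (simp only: mult_ac)
    then show ?thesis
      by (intro DERIV_cong[OF DERIV_mult[OF D DERIV_power_Suc[OF DERIV_sin]]])
        (simp add: d pderiv_mult algebra_simps power2_eq_square)
  qed
  then have "integral {0..pi} (\<lambda>t. real d * ?H t - ?G t) = 0"
    by (rule integral_derivative_vanishing) simp
  moreover have "(\<lambda>t. real d * ?H t) integrable_on {0..pi}" "?G integrable_on {0..pi}"
    by (intro integrable_continuous_real continuous_intros)+
  ultimately have "real d * integral {0..pi} ?H = integral {0..pi} ?G"
    by (simp add: integral_diff)
  then show ?thesis
    using assms by (simp add: pint_def d zint_Suc c_def field_simps)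
qed

text \<open>Each integration by parts differentiates \<open>p\<close> once, and a polynomial of
  degree below \<open>k\<close> does not survive \<open>k\<close> derivatives.\<close>

lemma geg_orthogonal:
  assumes "d > 0" "degree p < k"
  shows "pint d (p * geg k d) = 0"
  using assms
proof (induction k arbitrary: d p)
  case (Suc k)
  have "pint (d + 2) (pderiv p * geg k (d + 2)) = 0"
  proof (cases "degree p = 0")
    case True
    then have "pderiv p = 0" by (simp add: pderiv_eq_0_iff)
    then show ?thesis by simp
  next
    case False
    then show ?thesis using Suc by (simp add: degree_pderiv)
  qed
  then show ?case using Suc.prems by (simp add: pint_mult_geg_Suc)
qed simp

text \<open>Derivatives of \<open>(1 + x) ^ m\<close> are nonnegative multiples of lower powers, so
  repeated integration by parts ends in the integral of a nonnegative function or in zero.\<close>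

lemma pint_power_mult_geg_nonneg:
  assumes "d > 0"
  shows "0 \<le> pint d ([:1, 1:] ^ m * geg k d)"
  using assms
proof (induction k arbitrary: d m)
  case 0
  show ?case by (rule pint_nonneg) simp
next
  case (Suc k)
  show ?case
  proof (cases m)
    case 0
    then show ?thesis
      using Suc.prems pint_mult_geg_Suc[of d 1 k] by simp
  next
    case (Suc n)
    have "pderiv ([:1, 1:] ^ m) = smult (real m) ([:1, 1:] ^ n :: real poly)"
      unfolding Suc pderiv_power_Suc by (simp add: pderiv_pCons)
    then show ?thesis
      using Suc.IH[of "d + 2" n] Suc.prems
      by (simp add: pint_mult_geg_Suc pint_smult)
  qed
qed

lemma pint_square_eq_0D:
  assumes "pint d (p * p) = 0" "d > 0"
  shows "p = 0"
proof (rule ccontr)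
  assume "p \<noteq> 0"
  obtain e where "d = Suc e" using assms(2) by (cases d) auto
  then have "poly (p * p) x = 0" if "x \<in> {-1<..<1}" for x
    using assms that unfolding pint_def by (intro zint_eq_0D[of "poly (p * p)" e]) (auto intro!: continuous_intros)
  then have "{-1<..<1} \<subseteq> {x. poly p x = 0}" by auto
  then have "finite {-1<..<1::real}"
    using poly_roots_finite[OF \<open>p \<noteq> 0\<close>] finite_subset by blast
  then show False by (simp add: infinite_Ioo)
qed

definition geg_norm :: "nat \<Rightarrow> nat \<Rightarrow> real" where
  "geg_norm k d = pint d (geg k d * geg k d)"

lemma geg_norm_pos:
  assumes "d > 0"
  shows "0 < geg_norm k d"
proof -
  have "geg k d \<noteq> 0" using poly_geg_1[of k d] by force
  then have "geg_norm k d \<noteq> 0"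
    unfolding geg_norm_def using pint_square_eq_0D assms by blast
  moreover have "0 \<le> geg_norm k d"
    unfolding geg_norm_def by (rule pint_nonneg) simp
  ultimately show ?thesis by simp
qed

lemma pint_geg_geg:
  assumes "d > 0"
  shows "pint d (geg j d * geg k d) = (if j = k then geg_norm k d else 0)"
proof (cases j k rule: linorder_cases)
  case less
  then show ?thesis using geg_orthogonal[OF assms, of "geg j d" k] degree_geg[of j d] by simp
next
  case greater
  then show ?thesis
    using geg_orthogonal[OF assms, of "geg k d" j] degree_geg[of k d] by (simp add: mult.commute)
qed (simp add: geg_norm_def)

lemma poly_geg_expansion:
  assumes "d > 0" "degree p \<le> n"
  shows "p = (\<Sum>k\<le>n. smult (pint d (p * geg k d) / geg_norm k d) (geg k d))"
proof -
  have "\<exists>c. p = (\<Sum>k\<le>n. smult (c k) (geg k d))"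
    using assms(2)
  proof (induction n arbitrary: p)
    case 0
    then show ?case by (auto elim!: degree_eq_zeroE intro!: exI[of _ "\<lambda>_. coeff p 0"])
  next
    case (Suc n)
    define c where "c = coeff p (Suc n) / coeff (geg (Suc n) d) (Suc n)"
    define q where "q = p - smult c (geg (Suc n) d)"
    have "degree q \<le> n"
    proof (rule degree_le, intro allI impI)
      fix i assume "n < i"
      show "coeff q i = 0"
      proof (cases "i = Suc n")
        case True
        then show ?thesis
          using coeff_geg_pos[OF assms(1), of "Suc n"] by (simp add: q_def c_def)
      next
        case False
        then have "degree p < i" "degree (geg (Suc n) d) < i"
          using \<open>n < i\<close> Suc.prems degree_geg[of "Suc n" d] by linarith+
        then show ?thesis by (simp add: q_def coeff_eq_0)
      qed
    qed
    then obtain a where "q = (\<Sum>k\<le>n. smult (a k) (geg k d))" using Suc.IH by blast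
    then have "p = (\<Sum>k\<le>Suc n. smult ((a(Suc n := c)) k) (geg k d))"
      by (simp add: q_def algebra_simps)
    then show ?case by blast
  qed
  then obtain c where c: "p = (\<Sum>k\<le>n. smult (c k) (geg k d))" by blast
  have "pint d (p * geg j d) = c j * geg_norm j d" if "j \<le> n" for j
    using that
    by (subst c) (simp add: sum_distrib_right pint_sum pint_smult pint_geg_geg[OF assms(1)] if_distrib
        cong: if_cong)
  then show ?thesis
    using geg_norm_pos[OF assms(1)] by (subst c) (intro sum.cong, simp_all add: less_imp_neq[THEN not_sym])
qed

subsection \<open>The product formula\<close>

text \<open>
  \<open>disc_int e\<close> integrates over \<open>S\<^bsup>e + 1\<^esup>\<close> a function of two orthonormal coordinates \<open>a, b\<close>: given \<open>a\<close>, the other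
  coordinate is \<open>sqrt (1 - a\<^sup>2) * r\<close> with \<open>r\<close> a coordinate on \<open>S\<^sup>e\<close>.  Rotation invariance is obtained from
  the moments alone, for polynomials only.
\<close>

definition disc_int :: "nat \<Rightarrow> (real \<Rightarrow> real \<Rightarrow> real) \<Rightarrow> real" where
  "disc_int e g = zint (Suc e) (\<lambda>a. zint e (\<lambda>r. g a (sqrt (1 - a\<^sup>2) * r)))"

lemma disc_int_sum:
  assumes "finite I" "\<And>i. i \<in> I \<Longrightarrow> continuous_on UNIV (\<lambda>(a, b). g i a b)"
  shows "disc_int e (\<lambda>a b. \<Sum>i\<in>I. c i * g i a b) = (\<Sum>i\<in>I. c i * disc_int e (g i))"
proof -
  have *: "continuous_on ({-1..1} \<times> {-1..1}) (\<lambda>(a, r). g i a (sqrt (1 - a\<^sup>2) * r))" if "i \<in> I" for i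
  proof -
    have "continuous_on ({-1..1} \<times> {-1..1}) (\<lambda>x. (fst x, sqrt (1 - (fst x)\<^sup>2) * snd x) :: real \<times> real)"
      by (intro continuous_intros)
    from continuous_on_compose2[OF assms(2)[OF that] this] show ?thesis
      by (simp add: case_prod_beta)
  qed
  have "zint e (\<lambda>r. \<Sum>i\<in>I. c i * g i a (sqrt (1 - a\<^sup>2) * r))
      = (\<Sum>i\<in>I. c i * zint e (\<lambda>r. g i a (sqrt (1 - a\<^sup>2) * r)))" if "a \<in> {-1..1}" for a
  proof -
    have "continuous_on {-1..1} (\<lambda>r. g i a (sqrt (1 - a\<^sup>2) * r))" if "i \<in> I" for i
    proof -
      have "continuous_on {-1..1} (\<lambda>r. (a, r))" by (intro continuous_intros)
      moreover have "(\<lambda>r. (a, r)) ` {-1..1} \<subseteq> {-1..1} \<times> {-1..1}" using \<open>a \<in> _\<close> by auto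
      ultimately have "continuous_on {-1..1} (\<lambda>r. case (a, r) of (a, r) \<Rightarrow> g i a (sqrt (1 - a\<^sup>2) * r))"
        by (rule continuous_on_compose2[OF *[OF that]])
      then show ?thesis by simp
    qed
    then show ?thesis
      using assms(1) by (subst zint_sum) (auto simp: zint_cmult intro!: continuous_intros)
  qed
  then have "disc_int e (\<lambda>a b. \<Sum>i\<in>I. c i * g i a b)
      = zint (Suc e) (\<lambda>a. \<Sum>i\<in>I. c i * zint e (\<lambda>r. g i a (sqrt (1 - a\<^sup>2) * r)))"
    unfolding disc_int_def by (rule zint_cong)
  also have "\<dots> = (\<Sum>i\<in>I. c i * disc_int e (g i))"
    using assms(1) * by (subst zint_sum) (auto simp: zint_cmult disc_int_def intro!: continuous_intros continuous_on_zint)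
  finally show ?thesis .
qed

lemma disc_int_mult_power:
  "disc_int e (\<lambda>a b. f a * b ^ q) = zint (Suc e) (\<lambda>a. f a * sqrt (1 - a\<^sup>2) ^ q) * zint e (\<lambda>r. r ^ q)"
proof -
  have "zint e (\<lambda>r. f a * (sqrt (1 - a\<^sup>2) * r) ^ q) = zint e (\<lambda>r. r ^ q) * (f a * sqrt (1 - a\<^sup>2) ^ q)" for a
    using zint_cmult[of e "f a * sqrt (1 - a\<^sup>2) ^ q" "\<lambda>r. r ^ q"]
    by (simp add: power_mult_distrib mult_ac)
  then show ?thesis unfolding disc_int_def by (simp only: zint_cmult) (rule mult.commute)
qed

text \<open>On \<open>[0, pi]\<close> the root is \<open>sin t\<close>, so a power \<open>q\<close>
  of it raises the dimension by \<open>q\<close>; this covers odd \<open>q\<close> as well.\<close>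

lemma zint_power_sqrt: "zint (Suc e) (\<lambda>a. a ^ p * sqrt (1 - a\<^sup>2) ^ q) = zint (Suc (q + e)) (\<lambda>a. a ^ p)"
  unfolding zint_Suc
proof (rule integral_cong)
  fix t assume "t \<in> {0..pi}"
  then have "sqrt (1 - (cos t)\<^sup>2) = sin t"
    by (simp add: sin_squared_eq[symmetric] sin_ge_zero)
  then show "cos t ^ p * sqrt (1 - (cos t)\<^sup>2) ^ q * sin t ^ e = cos t ^ p * sin t ^ (q + e)"
    by (simp add: power_add)
qed

lemma sqrt_1_minus_sq: "x \<in> {-1..1} \<Longrightarrow> (sqrt (1 - x\<^sup>2))\<^sup>2 = 1 - x\<^sup>2" for x :: real
  by (simp add: abs_square_le_1 abs_le_iff)

section \<open>Moments of two orthonormal coordinates and their rotation invariance\<close>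

definition disc_moment :: "nat \<Rightarrow> nat \<Rightarrow> nat \<Rightarrow> real" where
  "disc_moment e p q = disc_int e (\<lambda>a b. a ^ p * b ^ q)"

lemma disc_moment_eq: "disc_moment e p q = zint (Suc (q + e)) (\<lambda>a. a ^ p) * zint e (\<lambda>r. r ^ q)"
  by (simp add: disc_moment_def disc_int_mult_power zint_power_sqrt)

lemma disc_moment_odd: "odd p \<or> odd q \<Longrightarrow> disc_moment e p q = 0"
  by (auto simp: disc_moment_eq zint_odd_moment)

text \<open>Infinitesimal rotation invariance: the derivative of
  \<open>a ^ (p + 1) * b ^ (q + 1)\<close> along a rotation of the two coordinates has integral
  zero. It is assembled from the one-variable recursion in each coordinate.\<close>

lemma disc_moment_rec: "(real q + 1) * disc_moment e (p + 2) q = (real p + 1) * disc_moment e p (q + 2)"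
proof -
  let ?Z = "\<lambda>p q. zint (Suc (q + e)) (\<lambda>a. a ^ p)"
  have "?Z p (q + 2) = zint (Suc (q + e)) (\<lambda>a. a ^ p * sqrt (1 - a\<^sup>2) ^ 2)"
    using zint_power_sqrt[of "q + e" p 2] by (simp add: add_ac)
  also have "\<dots> = zint (Suc (q + e)) (\<lambda>a. a ^ p - a ^ (p + 2))"
    by (rule zint_cong) (simp only: sqrt_1_minus_sq power_add right_diff_distrib mult_1_right)
  also have "\<dots> = ?Z p q - ?Z (p + 2) q"
    by (intro zint_diff continuous_intros)
  finally have *: "?Z p (q + 2) = ?Z p q - ?Z (p + 2) q" .
  have "(real q + 1 + real e) * ?Z (p + 2) q = (real p + 1) * ?Z p (q + 2)"
    using zint_moment_rec[of p "Suc (q + e)"] unfolding * by (simp add: algebra_simps)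
  then have "(real p + 1) * disc_moment e p (q + 2)
      = (real q + 1 + real e) * ?Z (p + 2) q * zint e (\<lambda>r. r ^ (q + 2))"
    unfolding disc_moment_eq by (simp only: mult.assoc[symmetric])
  also have "\<dots> = ?Z (p + 2) q * ((real q + 1 + real e) * zint e (\<lambda>r. r ^ (q + 2)))"
    by (simp only: mult_ac)
  also have "\<dots> = (real q + 1) * disc_moment e (p + 2) q"
    unfolding zint_moment_rec disc_moment_eq by (simp only: mult_ac)
  finally show ?thesis ..
qed

text \<open>The recursion shifts powers from \<open>b\<close> to \<open>a\<close> two at a time. The
  last factor depends only on \<open>i + j\<close>; the factorials before it are what turns
  \<open>2 * n choose (2 * i)\<close> into \<open>n choose i\<close> in the next lemma.\<close>

lemma disc_moment_even:
  "disc_moment e (2 * i) (2 * j) = fact (2 * i) * fact (2 * j) / (fact i * fact j) *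
     (disc_moment e (2 * (i + j)) 0 * fact (i + j) / fact (2 * (i + j)))"
proof (induction j arbitrary: i)
  case (Suc j)
  define K where "K = disc_moment e (2 * (i + Suc j)) 0 * fact (i + Suc j) / fact (2 * (i + Suc j))"
  have "(2 * real i + 1) * disc_moment e (2 * i) (2 * Suc j) = (2 * real j + 1) * disc_moment e (2 * Suc i) (2 * j)"
    using disc_moment_rec[of "2 * j" e "2 * i"] by simp
  also have "\<dots> = (2 * real j + 1) * (fact (2 * Suc i) * fact (2 * j) / (fact (Suc i) * fact j) * K)"
    by (subst Suc.IH) (simp add: K_def)
  also have "\<dots> = (2 * real i + 1) * (fact (2 * i) * fact (2 * Suc j) / (fact i * fact (Suc j)) * K)"
    by (simp add: divide_simps) (simp add: algebra_simps)
  finally have "disc_moment e (2 * i) (2 * Suc j) = fact (2 * i) * fact (2 * Suc j) / (fact i * fact (Suc j)) * K"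
    by (subst (asm) mult_left_cancel) (auto simp: add_eq_0_iff)
  then show ?case by (simp only: K_def)
qed simp

lemma binomial_mom:
  assumes "i \<le> n"
  shows "real (2 * n choose (2 * i)) * disc_moment e (2 * i) (2 * (n - i)) = real (n choose i) * disc_moment e (2 * n) 0"
proof -
  have "real (2 * n choose (2 * i)) = fact (2 * n) / (fact (2 * i) * fact (2 * (n - i)))"
    using assms by (simp add: binomial_fact right_diff_distrib')
  moreover have "real (n choose i) = fact n / (fact i * fact (n - i))"
    using assms by (simp add: binomial_fact)
  ultimately show ?thesis using assms by (simp add: disc_moment_even[of e i "n - i"])
qed

lemma sum_even_terms:
  fixes g :: "nat \<Rightarrow> real"
  assumes "\<And>k. odd k \<Longrightarrow> g k = 0"
  shows "(\<Sum>k\<le>2 * n. g k) = (\<Sum>i\<le>n. g (2 * i))"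
  by (induction n) (simp_all add: assms)

lemma disc_int_power_linear: 
  "disc_int e (\<lambda>a b. (s * a + t * b) ^ n) = (\<Sum>k\<le>n. real (n choose k) * s ^ k * t ^ (n - k) * disc_moment e k (n - k))"
proof -
  have "disc_int e (\<lambda>a b. (s * a + t * b) ^ n)
      = disc_int e (\<lambda>a b. \<Sum>k\<le>n. (real (n choose k) * s ^ k * t ^ (n - k)) * (a ^ k * b ^ (n - k)))"
    by (simp add: binomial_ring power_mult_distrib mult_ac)
  also have "\<dots> = (\<Sum>k\<le>n. real (n choose k) * s ^ k * t ^ (n - k) * disc_moment e k (n - k))"
    unfolding disc_moment_def
    by (rule disc_int_sum) (auto simp: case_prod_beta intro!: continuous_intros)
  finally show ?thesis .
qed

text \<open>For \<open>n = 2 * m\<close> the moment is a constant times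
  \<open>(s\<^sup>2 + t\<^sup>2) ^ m\<close>. For odd \<open>n\<close> every monomial has an odd
  exponent and the moment vanishes.\<close>

lemma disc_int_power_linear_rotate:
  assumes "s\<^sup>2 + t\<^sup>2 = s'\<^sup>2 + t'\<^sup>2"
  shows "disc_int e (\<lambda>a b. (s * a + t * b) ^ n) = disc_int e (\<lambda>a b. (s' * a + t' * b) ^ n)"
proof (cases "even n")
  case True
  then obtain m where n: "n = 2 * m" by (elim evenE)
  have "disc_int e (\<lambda>a b. (s * a + t * b) ^ n) = disc_moment e (2 * m) 0 * (s\<^sup>2 + t\<^sup>2) ^ m" for s t
  proof -
    have "disc_int e (\<lambda>a b. (s * a + t * b) ^ n)
       = (\<Sum>i\<le>m. real (n choose (2 * i)) * s ^ (2 * i) * t ^ (n - 2 * i) * disc_moment e (2 * i) (n - 2 * i))"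
      unfolding disc_int_power_linear unfolding n by (rule sum_even_terms) (simp add: disc_moment_odd)
    also have "\<dots> = (\<Sum>i\<le>m. real (m choose i) * (s\<^sup>2) ^ i * (t\<^sup>2) ^ (m - i) * disc_moment e (2 * m) 0)"
    proof (rule sum.cong)
      fix i assume "i \<in> {..m}"
      then have *: "real (n choose (2 * i)) * disc_moment e (2 * i) (n - 2 * i) = real (m choose i) * disc_moment e (2 * m) 0"
        using binomial_mom[of i m e] by (simp add: n right_diff_distrib')
      have "real (n choose (2 * i)) * s ^ (2 * i) * t ^ (n - 2 * i) * disc_moment e (2 * i) (n - 2 * i)
          = (real (n choose (2 * i)) * disc_moment e (2 * i) (n - 2 * i)) * ((s\<^sup>2) ^ i * (t\<^sup>2) ^ (m - i))"
        by (simp add: n right_diff_distrib' diff_mult_distrib mult_ac flip: power_mult)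
      then show "real (n choose (2 * i)) * s ^ (2 * i) * t ^ (n - 2 * i) * disc_moment e (2 * i) (n - 2 * i)
          = real (m choose i) * (s\<^sup>2) ^ i * (t\<^sup>2) ^ (m - i) * disc_moment e (2 * m) 0"
        unfolding * by (simp only: mult_ac)
    qed simp
    finally show ?thesis by (simp add: binomial_ring sum_distrib_left mult_ac)
  qed
  then show ?thesis using assms by simp
next
  case False
  then have "disc_moment e k (n - k) = 0" if "k \<le> n" for k
    using that by (intro disc_moment_odd) auto
  then show ?thesis by (simp add: disc_int_power_linear)
qed

text \<open>
  Both sides are the coefficients, up to the same binomial factor, of a polynomial in \<open>x\<close>: the
  moment of \<open>(x a + b)\<^sup>n\<close> depends only on \<open>x\<^sup>2 + 1\<close>, which rotation preserves.
\<close>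

lemma disc_int_monomial_rotate:
  assumes "c\<^sup>2 + s\<^sup>2 = 1"
  shows "disc_int e (\<lambda>a b. (c * a + s * b) ^ p * (c * b - s * a) ^ q) = disc_moment e p q"
proof -
  define n where "n = p + q"
  define M where "M k = disc_int e (\<lambda>a b. (c * a + s * b) ^ k * (c * b - s * a) ^ (n - k))" for k
  have "(\<Sum>k\<le>n. real (n choose k) * M k * x ^ k) = (\<Sum>k\<le>n. real (n choose k) * disc_moment e k (n - k) * x ^ k)" for x
  proof -
    have "(\<Sum>k\<le>n. real (n choose k) * disc_moment e k (n - k) * x ^ k) = disc_int e (\<lambda>a b. (x * a + 1 * b) ^ n)"
      unfolding disc_int_power_linear by (simp add: mult_ac)
    \<comment> \<open>These are the coefficients of \<open>x\<close> times the rotated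
      \<open>a\<close> plus the rotated \<open>b\<close>; the vector has the same length as
      \<open>(x, 1)\<close>.\<close>
    also have "\<dots> = disc_int e (\<lambda>a b. ((x * c - s) * a + (x * s + c) * b) ^ n)"
    proof (rule disc_int_power_linear_rotate)
      have "(x * c - s)\<^sup>2 + (x * s + c)\<^sup>2 = (x\<^sup>2 + 1) * (c\<^sup>2 + s\<^sup>2)"
        by (simp add: power2_eq_square algebra_simps)
      then show "x\<^sup>2 + 1\<^sup>2 = (x * c - s)\<^sup>2 + (x * s + c)\<^sup>2" using assms by simp
    qed
    also have "\<dots> = disc_int e (\<lambda>a b. (x * (c * a + s * b) + (c * b - s * a)) ^ n)"
      by (simp add: algebra_simps)
    also have "\<dots> = disc_int e (\<lambda>a b. \<Sum>k\<le>n. (real (n choose k) * x ^ k) * ((c * a + s * b) ^ k * (c * b - s * a) ^ (n - k)))"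
      by (subst binomial_ring) (simp add: power_mult_distrib mult_ac)
    also have "\<dots> = (\<Sum>k\<le>n. (real (n choose k) * x ^ k) * M k)"
      unfolding M_def by (rule disc_int_sum) (auto simp: case_prod_beta intro!: continuous_intros)
    finally show ?thesis by (simp add: mult_ac)
  qed
  then have "real (n choose p) * M p = real (n choose p) * disc_moment e p (n - p)"
    using polyfun_eq_coeffs[where n=n and c="\<lambda>k. real (n choose k) * M k" and d="\<lambda>k. real (n choose k) * disc_moment e k (n - k)"]
    by (simp add: n_def)
  then show ?thesis by (simp add: M_def n_def)
qed

text \<open>The family may repeat exponents, so a product of two expanded sums can be inserted with
  its double index as it stands.\<close>

lemma disc_int_rotate:
  fixes w :: "'i \<Rightarrow> real" and p q :: "'i \<Rightarrow> nat"
  assumes "c\<^sup>2 + s\<^sup>2 = 1" "finite I"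
  defines "g \<equiv> \<lambda>(a::real) (b::real). \<Sum>i\<in>I. w i * (a ^ p i * b ^ q i)"
  shows "disc_int e (\<lambda>a b. g (c * a + s * b) (c * b - s * a)) = disc_int e g"
proof -
  have "disc_int e (\<lambda>a b. g (c * a + s * b) (c * b - s * a))
      = (\<Sum>i\<in>I. w i * disc_int e (\<lambda>a b. (c * a + s * b) ^ p i * (c * b - s * a) ^ q i))"
    unfolding g_def using assms(2) by (intro disc_int_sum) (auto simp: case_prod_beta intro!: continuous_intros)
  also have "\<dots> = (\<Sum>i\<in>I. w i * disc_int e (\<lambda>a b. a ^ p i * b ^ q i))"
    by (simp add: disc_int_monomial_rotate[OF assms(1)] disc_moment_def)
  also have "\<dots> = disc_int e g"
    unfolding g_def using assms(2) by (intro disc_int_sum[symmetric]) (auto simp: case_prod_beta intro!: continuous_intros)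
  finally show ?thesis .
qed

text \<open>\<open>zadd x y r\<close> is the scalar product of two points of height \<open>x\<close>, \<open>y\<close> whose equatorial parts have cosine \<open>r\<close>.\<close>

definition zadd :: "real \<Rightarrow> real \<Rightarrow> real \<Rightarrow> real" where
  "zadd x y r = x * y + sqrt (1 - x\<^sup>2) * sqrt (1 - y\<^sup>2) * r"

text \<open>Twice each product is at most a sum of two squares, and the four squares add up to
  \<open>2\<close>.\<close>

lemma zadd_mem:
  assumes "x \<in> {-1..1}" "y \<in> {-1..1}" "r \<in> {-1..1}"
  shows "zadd x y r \<in> {-1..1}"
proof -
  let ?u = "sqrt (1 - x\<^sup>2)" and ?v = "sqrt (1 - y\<^sup>2)"
  have "\<bar>?u * ?v * r\<bar> \<le> \<bar>?u * ?v\<bar> * 1"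
    using assms(3) unfolding abs_mult by (intro mult_left_mono) auto
  moreover have "2 * \<bar>?u * ?v\<bar> \<le> ?u\<^sup>2 + ?v\<^sup>2"
    using sum_squares_bound[of "\<bar>?u\<bar>" "\<bar>?v\<bar>"] by (simp only: abs_mult power2_abs mult.assoc)
  moreover have "2 * \<bar>x * y\<bar> \<le> x\<^sup>2 + y\<^sup>2"
    using sum_squares_bound[of "\<bar>x\<bar>" "\<bar>y\<bar>"] by (simp only: abs_mult power2_abs mult.assoc)
  ultimately have "\<bar>x * y\<bar> + \<bar>?u * ?v * r\<bar> \<le> 1"
    using sqrt_1_minus_sq[OF assms(1)] sqrt_1_minus_sq[OF assms(2)] by linarith
  then show ?thesis by (simp add: zadd_def) linarith
qed

lemma pint_even_monom:
  "zint (Suc e) (\<lambda>a. poly p a * a ^ i * sqrt (1 - a\<^sup>2) ^ (2 * l)) = pint (Suc e) ((monom 1 i * [:1, 0, -1:] ^ l) * p)"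
  unfolding pint_def
proof (rule zint_cong)
  fix x :: real assume "x \<in> {-1..1}"
  then have "sqrt (1 - x\<^sup>2) ^ (2 * l) = (1 - x * x) ^ l"
    by (simp only: power_mult sqrt_1_minus_sq) (simp add: power2_eq_square)
  then show "poly p x * x ^ i * sqrt (1 - x\<^sup>2) ^ (2 * l) = poly ((monom 1 i * [:1, 0, -1:] ^ l) * p) x"
    by (simp add: poly_monom poly_power mult_ac)
qed

lemma degree_monom_power: "degree (monom (c :: real) i * [:1, 0, -1:] ^ l) \<le> i + 2 * l"
proof -
  have "degree (monom c i) \<le> i" by (rule degree_monom_le)
  moreover have "degree ([:1, 0, -1:] ^ l :: real poly) \<le> 2 * l"
    using degree_power_le[of "[:1, 0, -1:] :: real poly" l] by simp
  ultimately show ?thesis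
    using degree_mult_le[of "monom c i" "[:1, 0, -1:] ^ l"] by linarith
qed

lemma zint_power_affine:
  "zint e (\<lambda>r. (u + w * r) ^ n) = (\<Sum>i\<le>n. real (n choose i) * u ^ (n - i) * w ^ i * zint e (\<lambda>r. r ^ i))"
proof -
  have "(u + w * r) ^ n = (\<Sum>i\<le>n. (real (n choose i) * u ^ (n - i) * w ^ i) * r ^ i)" for r
    by (subst add.commute, subst binomial_ring) (simp add: power_mult_distrib mult_ac)
  then show ?thesis
    by (subst zint_sum[symmetric, where g="\<lambda>i r. (real (n choose i) * u ^ (n - i) * w ^ i) * r ^ i", simplified zint_cmult])
      (auto intro!: continuous_intros)
qed

text \<open>Odd powers of \<open>r\<close> integrate to zero, so only even powers of
  \<open>sqrt (1 - x\<^sup>2)\<close> survive. These are polynomials whose degree equals the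
  exponent of the root, so averaging over a slice does not raise the degree.\<close>

lemma zint_zadd_poly:
  obtains U where "degree U \<le> degree p" "\<And>x. x \<in> {-1..1} \<Longrightarrow> zint e (\<lambda>r. poly p (zadd x y r)) = poly U x"
proof
  define s where "s = sqrt (1 - y\<^sup>2)"
  define V where "V n i = (if even i then smult (real (n choose i) * y ^ (n - i) * s ^ i * zint e (\<lambda>r. r ^ i))
      (monom 1 (n - i) * [:1, 0, -1:] ^ (i div 2)) else 0)" for n i
  define U where "U = (\<Sum>n\<le>degree p. smult (coeff p n) (\<Sum>i\<le>n. V n i))"
  have "degree (V n i) \<le> n" if "i \<le> n" for n i
    using that degree_monom_power[of 1 "n - i" "i div 2"]
    by (auto simp: V_def intro!: order.trans[OF degree_smult_le])
  then show "degree U \<le> degree p"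
    unfolding U_def
    by (intro degree_sum_le order.trans[OF degree_smult_le]) (auto intro: order.trans)
  fix x :: real assume x: "x \<in> {-1..1}"
  have "zint e (\<lambda>r. poly p (zadd x y r)) = zint e (\<lambda>r. \<Sum>n\<le>degree p. coeff p n * (x * y + sqrt (1 - x\<^sup>2) * s * r) ^ n)"
    by (simp add: poly_altdef zadd_def s_def)
  also have "\<dots> = (\<Sum>n\<le>degree p. coeff p n * zint e (\<lambda>r. (x * y + sqrt (1 - x\<^sup>2) * s * r) ^ n))"
    by (subst zint_sum) (auto simp: zint_cmult intro!: continuous_intros)
  also have "\<dots> = (\<Sum>n\<le>degree p. coeff p n * (\<Sum>i\<le>n. poly (V n i) x))"
  proof (intro sum.cong refl arg_cong2[where f="(*)"])
    fix n
    have "real (n choose i) * (x * y) ^ (n - i) * (sqrt (1 - x\<^sup>2) * s) ^ i * zint e (\<lambda>r. r ^ i) = poly (V n i) x" for i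
    proof (cases "even i")
      case True
      then obtain l where i: "i = 2 * l" by (elim evenE)
      have "sqrt (1 - x\<^sup>2) ^ i = (1 - x * x) ^ l"
        using x by (simp only: i power_mult sqrt_1_minus_sq) (simp add: power2_eq_square)
      then show ?thesis
        using True by (simp add: V_def poly_monom poly_power power_mult_distrib mult_ac i)
    qed (simp add: V_def zint_odd_moment)
    then show "zint e (\<lambda>r. (x * y + sqrt (1 - x\<^sup>2) * s * r) ^ n) = (\<Sum>i\<le>n. poly (V n i) x)"
      unfolding zint_power_affine by simp
  qed
  also have "\<dots> = poly U x" by (simp add: U_def poly_sum)
  finally show "zint e (\<lambda>r. poly p (zadd x y r)) = poly U x" .
qed

lemma power_linear_expand:
  fixes y s a b :: real
  shows "(y * a - s * b) ^ j = (\<Sum>i\<le>j. (real (j choose i) * y ^ i * (-s) ^ (j - i)) * (a ^ i * b ^ (j - i)))"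
proof -
  have "y * a - s * b = y * a + (-s) * b" by simp
  then show ?thesis by (simp only: binomial_ring power_mult_distrib mult_ac)
qed

text \<open>Odd powers of \<open>b\<close> integrate to zero. In a surviving term with
  \<open>j - i = 2 * l\<close> the cofactor of \<open>p\<close> has degree at most
  \<open>i + 2 * l = j\<close>, which is below \<open>k\<close>.\<close>

lemma disc_int_geg_eq_0:
  assumes "j < k" "p = geg k (Suc e)"
  shows "disc_int e (\<lambda>a b. poly p a * (y * a - s * b) ^ j) = 0"
proof -
  have "disc_int e (\<lambda>a b. poly p a * (y * a - s * b) ^ j)
      = disc_int e (\<lambda>a b. \<Sum>i\<le>j. (real (j choose i) * y ^ i * (-s) ^ (j - i)) * ((poly p a * a ^ i) * b ^ (j - i)))"
    unfolding power_linear_expand sum_distrib_left by (simp only: mult_ac)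
  also have "\<dots> = (\<Sum>i\<le>j. (real (j choose i) * y ^ i * (-s) ^ (j - i)) * disc_int e (\<lambda>a b. (poly p a * a ^ i) * b ^ (j - i)))"
    by (intro disc_int_sum) (auto simp: case_prod_beta intro!: continuous_intros)
  also have "\<dots> = 0"
  proof (intro sum.neutral ballI)
    fix i assume i: "i \<in> {..j}"
    have "disc_int e (\<lambda>a b. (poly p a * a ^ i) * b ^ (j - i)) = 0"
    proof (cases "even (j - i)")
      case True
      then obtain l where l: "j - i = 2 * l" by (elim evenE)
      have "pint (Suc e) ((monom 1 i * [:1, 0, -1:] ^ l) * p) = 0"
        unfolding assms(2) using degree_monom_power[of 1 i l] l i assms(1)
        by (intro geg_orthogonal) auto
      then show ?thesis by (simp only: disc_int_mult_power l pint_even_monom)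
    qed (simp add: disc_int_mult_power zint_odd_moment)
    then show "(real (j choose i) * y ^ i * (-s) ^ (j - i)) * disc_int e (\<lambda>a b. (poly p a * a ^ i) * b ^ (j - i)) = 0"
      by simp
  qed
  finally show ?thesis .
qed

text \<open>In \<open>x\<close>, the left side is a polynomial \<open>U\<close> of degree at most
  \<open>k\<close>. Rotating the two coordinates shows that \<open>U\<close> is orthogonal to all
  lower powers, which leaves a multiple of \<open>geg k\<close>. The value at \<open>x = 1\<close>,
  where \<open>zadd 1 y r = y\<close>, fixes the multiple.\<close>

theorem geg_product_formula:
  assumes "x \<in> {-1..1}" "y \<in> {-1..1}"
  shows "zint e (\<lambda>r. poly (geg k (Suc e)) (zadd x y r))
    = zint e (\<lambda>r. 1) * poly (geg k (Suc e)) x * poly (geg k (Suc e)) y"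
proof -
  define p where "p = geg k (Suc e)"
  define s where "s = sqrt (1 - y\<^sup>2)"
  have ys: "y\<^sup>2 + s\<^sup>2 = 1" using assms(2) by (simp only: s_def sqrt_1_minus_sq)
  obtain U where U: "degree U \<le> degree p"
    "\<And>x. x \<in> {-1..1} \<Longrightarrow> zint e (\<lambda>r. poly p (zadd x y r)) = poly U x"
    using zint_zadd_poly by blast
  have orth: "pint (Suc e) (U * monom 1 j) = 0" if "j < k" for j
  proof -
    \<comment> \<open>The height \<open>a\<close> in terms of the rotated coordinates: the integrand
      becomes a polynomial in \<open>y * a + s * b\<close> and \<open>y * b - s * a\<close> alone,
      ready for \<open>disc_int_rotate\<close>.\<close>
    have a: "y * (y * a + s * b) - s * (y * b - s * a) = a" for a b
    proof -
      have "y * (y * a + s * b) - s * (y * b - s * a) = (y\<^sup>2 + s\<^sup>2) * a"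
        by (simp add: power2_eq_square algebra_simps)
      then show ?thesis using ys by simp
    qed
    let ?w = "\<lambda>(n, i). coeff p n * real (j choose i) * y ^ i * (-s) ^ (j - i)"
    let ?I = "{..degree p} \<times> {..j}"
    have g: "poly p a * (y * a - s * b) ^ j = (\<Sum>t\<in>?I. ?w t * (a ^ (fst t + snd t) * b ^ (j - snd t)))" for a b
      unfolding power_linear_expand poly_altdef sum_product sum.cartesian_product case_prod_beta
      by (simp only: power_add mult_ac)
    have "pint (Suc e) (U * monom 1 j) = zint (Suc e) (\<lambda>a. zint e (\<lambda>r. poly p (zadd a y r)) * a ^ j)"
      unfolding pint_def by (rule zint_cong) (simp add: U(2) poly_monom)
    also have "\<dots> = disc_int e (\<lambda>a b. poly p (y * a + s * b) * a ^ j)"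
      unfolding disc_int_def
      using zint_cmult[of e] by (simp add: zadd_def s_def mult_ac)
    also have "\<dots> = disc_int e (\<lambda>a b. \<Sum>t\<in>?I. ?w t * ((y * a + s * b) ^ (fst t + snd t) * (y * b - s * a) ^ (j - snd t)))"
      by (simp only: g[symmetric] a)
    also have "\<dots> = disc_int e (\<lambda>a b. \<Sum>t\<in>?I. ?w t * (a ^ (fst t + snd t) * b ^ (j - snd t)))"
      by (rule disc_int_rotate[OF ys]) simp
    also have "\<dots> = 0"
      unfolding g[symmetric] using that by (rule disc_int_geg_eq_0) (simp add: p_def)
    finally show ?thesis .
  qed
  have "pint (Suc e) (U * geg i (Suc e)) = 0" if "i < k" for i
  proof -
    have "U * geg i (Suc e) = (\<Sum>j\<le>degree (geg i (Suc e)). smult (coeff (geg i (Suc e)) j) (U * monom 1 j))"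
      by (subst (1) poly_as_sum_of_monoms[of "geg i (Suc e)", symmetric])
        (simp add: sum_distrib_left smult_monom flip: mult_smult_right)
    moreover have "degree (geg i (Suc e)) < k" using degree_geg[of i "Suc e"] that by simp
    ultimately show ?thesis by (simp add: pint_sum pint_smult orth)
  qed
  moreover have "U = (\<Sum>i\<le>k. smult (pint (Suc e) (U * geg i (Suc e)) / geg_norm i (Suc e)) (geg i (Suc e)))"
    using U(1) degree_geg[of k "Suc e"] by (intro poly_geg_expansion) (auto simp: p_def)
  ultimately obtain c where c: "U = smult c p"
    by (cases k) (auto simp: p_def simp flip: lessThan_Suc_atMost)
  have "poly U 1 = zint e (\<lambda>r. 1) * poly p y"
    using U(2)[of 1, symmetric] zint_const[of e "poly p y"] by (simp add: zadd_def mult.commute)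
  then have "c = zint e (\<lambda>r. 1) * poly p y" by (simp add: c p_def)
  then show ?thesis using U(2)[OF assms(1)] by (simp add: c p_def mult_ac)
qed

text \<open>At a maximum \<open>z\<close> of \<open>\<bar>c\<^sub>k\<bar>\<close>, the product formula with \<open>x = y = z\<close> gives \<open>c\<^sub>k(z)\<^sup>2 \<le> \<bar>c\<^sub>k(z)\<bar>\<close>.\<close>

lemma geg_bound:
  assumes "x \<in> {-1..1}" "d > 0"
  shows "\<bar>poly (geg k d) x\<bar> \<le> 1"
proof -
  obtain e where d: "d = Suc e" using assms(2) by (cases d) auto
  let ?p = "poly (geg k d)"
  have "\<exists>z\<in>{-1..1}. \<forall>y\<in>{-1..1}. \<bar>?p y\<bar> \<le> \<bar>?p z\<bar>"
    by (rule continuous_attains_sup) (auto intro!: continuous_intros)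
  then obtain z where z: "z \<in> {-1..1}" "\<And>y. y \<in> {-1..1} \<Longrightarrow> \<bar>?p y\<bar> \<le> \<bar>?p z\<bar>" by blast
  define S where "S = \<bar>?p z\<bar>"
  have "\<bar>zint e (\<lambda>r. ?p (zadd z z r))\<bar> \<le> S * zint e (\<lambda>x. 1)"
    using z zadd_mem[OF z(1) z(1)] unfolding S_def
    by (intro zint_bound) (auto simp: zadd_def intro!: continuous_intros)
  moreover have "\<bar>zint e (\<lambda>r. ?p (zadd z z r))\<bar> = zint e (\<lambda>x. 1) * S * S"
    unfolding S_def d geg_product_formula[OF z(1) z(1)] abs_mult using zint_one_pos[of e] by simp
  ultimately have "(zint e (\<lambda>x. 1) * S) * S \<le> (zint e (\<lambda>x. 1) * S) * 1"
    by (simp only: mult_ac mult_1_right)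
  moreover have "1 \<le> S" using z(2)[of 1] by (simp add: S_def)
  ultimately have "S \<le> 1"
    using zint_one_pos[of e] by (subst (asm) mult_le_cancel_left_pos) auto
  then show ?thesis using z(2)[OF assms(1)] unfolding S_def by linarith
qed

subsection \<open>Positive definite functions on spheres\<close>

lemma abs_cos_diff_le: "\<bar>cos s - cos t\<bar> \<le> \<bar>s - t\<bar>" for s t :: real
  using field_differentiable_bound[of UNIV cos "\<lambda>z. - sin z" 1 s t] by (auto intro!: derivative_eq_intros)

text \<open>A quadrature rule whose nodes and weights depend only on \<open>\<delta>\<close> and
  \<open>e\<close>, so that one rule serves all sections of a kernel. The weights integrate the
  density exactly over the cells, so the error comes only from the oscillation of \<open>g\<close>;
  as \<open>cos\<close> is 1-Lipschitz, an angular mesh of at most \<open>\<delta>\<close>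
  suffices.\<close>

lemma zint_riemann:
  assumes "\<delta> > 0"
  obtains N :: nat and x w :: "nat \<Rightarrow> real" where
    "\<And>i. x i \<in> {-1..1}" "\<And>i. 0 \<le> w i" "(\<Sum>i<N. w i) = zint (Suc e) (\<lambda>x. 1)"
    "\<And>g \<epsilon>. continuous_on {-1..1} g \<Longrightarrow>
       (\<And>s t. s \<in> {-1..1} \<Longrightarrow> t \<in> {-1..1} \<Longrightarrow> \<bar>s - t\<bar> \<le> \<delta> \<Longrightarrow> \<bar>g s - g t\<bar> \<le> \<epsilon>) \<Longrightarrow>
       \<bar>zint (Suc e) g - (\<Sum>i<N. w i * g (x i))\<bar> \<le> \<epsilon> * zint (Suc e) (\<lambda>x. 1)"
proof -
  obtain n :: nat where n: "pi / \<delta> < real n" using reals_Archimedean2 by blast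
  define N where "N = Suc n"
  \<comment> \<open>The cut-off at \<open>pi\<close> keeps the bounds valid for every
    \<open>i\<close>, not only for \<open>i \<le> N\<close>.\<close>
  define \<theta> where "\<theta> i = min pi (pi * real i / real N)" for i
  have N: "pi / real N \<le> \<delta>" "N > 0"
    using n assms by (simp_all add: N_def field_simps)
  have \<theta>: "\<theta> 0 = 0" "\<theta> N = pi" "\<theta> i \<le> \<theta> (Suc i)" "0 \<le> \<theta> i" "\<theta> i \<le> pi" "\<theta> (Suc i) - \<theta> i \<le> \<delta>" for i
  proof -
    have "pi * real (Suc i) / real N = pi * real i / real N + pi / real N"
      by (simp add: add_divide_distrib distrib_left)
    moreover have "0 \<le> pi / real N" "0 \<le> pi * real i / real N" by auto
    ultimately show "\<theta> i \<le> \<theta> (Suc i)" "0 \<le> \<theta> i" "\<theta> i \<le> pi" "\<theta> (Suc i) - \<theta> i \<le> \<delta>"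
      using N(1) pi_ge_zero unfolding \<theta>_def by linarith+
  qed (use N in \<open>auto simp: \<theta>_def\<close>)
  have split: "integral {0..\<theta> m} \<phi> = (\<Sum>i<m. integral {\<theta> i..\<theta> (Suc i)} \<phi>)"
    if "continuous_on {0..pi} \<phi>" for \<phi> :: "real \<Rightarrow> real" and m
  proof (induction m)
    case (Suc m)
    have "\<phi> integrable_on {0..\<theta> (Suc m)}"
      using \<theta>(5)[of "Suc m"] by (intro integrable_continuous_real continuous_on_subset[OF that]) auto
    then have "integral {0..\<theta> m} \<phi> + integral {\<theta> m..\<theta> (Suc m)} \<phi> = integral {0..\<theta> (Suc m)} \<phi>"
      using \<theta>(3,4)[of m] by (intro Henstock_Kurzweil_Integration.integral_combine) auto
    then show ?case using Suc by simp
  qed (simp add: \<theta>)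
  define w where "w i = integral {\<theta> i..\<theta> (Suc i)} (\<lambda>t. sin t ^ e)" for i
  have sub: "{\<theta> i..\<theta> (Suc i)} \<subseteq> {0..pi}" for i
    using \<theta>(4)[of i] \<theta>(5)[of "Suc i"] by auto
  have sin_int: "(\<lambda>t. sin t ^ e) integrable_on {\<theta> i..\<theta> (Suc i)}" for i
    by (intro integrable_continuous_real continuous_intros)
  have sin_nonneg: "0 \<le> sin t ^ e" if "t \<in> {\<theta> i..\<theta> (Suc i)}" for t i
    using sub[of i] that by (auto intro!: zero_le_power sin_ge_zero)
  have w: "0 \<le> w i" for i
    unfolding w_def using sin_int sin_nonneg by (rule integral_nonneg)
  have w_sum: "(\<Sum>i<N. w i) = zint (Suc e) (\<lambda>x. 1)"
    using split[of "\<lambda>t. sin t ^ e" N] by (simp add: w_def zint_Suc \<theta>(2) continuous_intros)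
  have approx: "\<bar>zint (Suc e) g - (\<Sum>i<N. w i * g (cos (\<theta> i)))\<bar> \<le> \<epsilon> * zint (Suc e) (\<lambda>x. 1)"
    if g: "continuous_on {-1..1} g"
      and osc: "\<And>s t. s \<in> {-1..1} \<Longrightarrow> t \<in> {-1..1} \<Longrightarrow> \<bar>s - t\<bar> \<le> \<delta> \<Longrightarrow> \<bar>g s - g t\<bar> \<le> \<epsilon>" for g \<epsilon>
  proof -
    let ?h = "\<lambda>t. g (cos t) * sin t ^ e"
    have h: "continuous_on {0..pi} ?h" by (rule continuous_on_zint_integrand[OF g])
    have "\<bar>integral {\<theta> i..\<theta> (Suc i)} ?h - w i * g (cos (\<theta> i))\<bar> \<le> \<epsilon> * w i" for i
    proof -
      have int: "(\<lambda>t. g (cos (\<theta> i)) * sin t ^ e) integrable_on {\<theta> i..\<theta> (Suc i)}"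
        "(\<lambda>t. \<epsilon> * sin t ^ e) integrable_on {\<theta> i..\<theta> (Suc i)}"
        by (intro integrable_continuous_real continuous_intros)+
      have h_int: "?h integrable_on {\<theta> i..\<theta> (Suc i)}"
        by (intro integrable_continuous_real continuous_on_subset[OF h] sub)
      have "integral {\<theta> i..\<theta> (Suc i)} ?h - w i * g (cos (\<theta> i))
          = integral {\<theta> i..\<theta> (Suc i)} (\<lambda>t. ?h t - g (cos (\<theta> i)) * sin t ^ e)"
        using h_int int(1) by (simp add: integral_diff w_def)
      also have "norm \<dots> \<le> integral {\<theta> i..\<theta> (Suc i)} (\<lambda>t. \<epsilon> * sin t ^ e)"
      proof (rule integral_norm_bound_integral)
        fix t assume t: "t \<in> {\<theta> i..\<theta> (Suc i)}"
        have "\<bar>cos t - cos (\<theta> i)\<bar> \<le> \<bar>t - \<theta> i\<bar>" by (rule abs_cos_diff_le)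
        also have "\<dots> \<le> \<delta>" using t \<theta>(6)[of i] by auto
        finally have "\<bar>g (cos t) - g (cos (\<theta> i))\<bar> \<le> \<epsilon>" by (intro osc) auto
        then have "\<bar>g (cos t) - g (cos (\<theta> i))\<bar> * sin t ^ e \<le> \<epsilon> * sin t ^ e"
          using sin_nonneg[OF t] by (rule mult_right_mono)
        then show "norm (?h t - g (cos (\<theta> i)) * sin t ^ e) \<le> \<epsilon> * sin t ^ e"
          using sin_nonneg[OF t] by (simp add: abs_mult flip: left_diff_distrib)
      qed (use h_int int in \<open>auto intro: integrable_diff\<close>)
      finally show ?thesis by (simp add: w_def)
    qed
    then have "\<bar>(\<Sum>i<N. integral {\<theta> i..\<theta> (Suc i)} ?h) - (\<Sum>i<N. w i * g (cos (\<theta> i)))\<bar> \<le> (\<Sum>i<N. \<epsilon> * w i)"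
      unfolding sum_subtractf[symmetric] by (intro order.trans[OF sum_abs] sum_mono)
    then show ?thesis
      using split[OF h, of N] w_sum by (simp add: zint_Suc \<theta>(2) flip: sum_distrib_left)
  qed
  show ?thesis
    by (rule that[of "\<lambda>i. cos (\<theta> i)" w N]) (use w w_sum approx in auto)
qed

lemma continuous_on_section:
  assumes "continuous_on (A \<times> B) (\<lambda>(x, y). K x y)"
  shows "x \<in> A \<Longrightarrow> continuous_on B (K x)" "y \<in> B \<Longrightarrow> continuous_on A (\<lambda>x. K x y)"
proof -
  assume "x \<in> A"
  then have "(\<lambda>y. (x, y)) ` B \<subseteq> A \<times> B" by auto
  moreover have "continuous_on B (\<lambda>y. (x, y))" by (intro continuous_intros)
  ultimately have "continuous_on B (\<lambda>y. case (x, y) of (x, y) \<Rightarrow> K x y)"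
    using continuous_on_compose2[OF assms] by blast
  then show "continuous_on B (K x)" by simp
next
  assume "y \<in> B"
  then have "(\<lambda>x. (x, y)) ` A \<subseteq> A \<times> B" by auto
  moreover have "continuous_on A (\<lambda>x. (x, y))" by (intro continuous_intros)
  ultimately have "continuous_on A (\<lambda>x. case (x, y) of (x, y) \<Rightarrow> K x y)"
    using continuous_on_compose2[OF assms] by blast
  then show "continuous_on A (\<lambda>x. K x y)" by simp
qed

text \<open>Using the same quadrature nodes in both variables turns the double integral into a
  quadratic form of \<open>K\<close>, up to an arbitrarily small error.\<close>

lemma zint_zint_nonneg:
  fixes K :: "real \<Rightarrow> real \<Rightarrow> real"
  assumes K: "continuous_on ({-1..1} \<times> {-1..1}) (\<lambda>(x, y). K x y)"
    and pd: "\<And>(N::nat) x w. (\<And>i. x i \<in> {-1..1}) \<Longrightarrow> 0 \<le> (\<Sum>i<N. \<Sum>j<N. w i * w j * K (x i) (x j))"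
  shows "0 \<le> zint (Suc e) (\<lambda>x. zint (Suc e) (K x))"
proof -
  define \<kappa> where "\<kappa> = zint (Suc e) (\<lambda>x. 1)"
  have \<kappa>: "0 < \<kappa>" unfolding \<kappa>_def by (rule zint_one_pos)
  have "-(2 * \<epsilon> * \<kappa> * \<kappa>) \<le> zint (Suc e) (\<lambda>x. zint (Suc e) (K x))" if "\<epsilon> > 0" for \<epsilon>
  proof -
    have "uniformly_continuous_on ({-1..1} \<times> {-1..1}) (\<lambda>(x, y). K x y)"
      using K by (intro compact_uniformly_continuous compact_Times) auto
    then obtain \<delta> where \<delta>: "\<delta> > 0" "\<And>p q. p \<in> {-1..1} \<times> {-1..1} \<Longrightarrow> q \<in> {-1..1} \<times> {-1..1} \<Longrightarrow>
        dist q p < \<delta> \<Longrightarrow> dist (case q of (x, y) \<Rightarrow> K x y) (case p of (x, y) \<Rightarrow> K x y) < \<epsilon>"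
      using \<open>\<epsilon> > 0\<close> by (rule uniformly_continuous_onE) blast
    \<comment> \<open>Uniform continuity is stated with a strict inequality, the quadrature rule
      with a weak one; halving bridges the two.\<close>
    from \<delta>(1) have "\<delta> / 2 > 0" by simp
    then show ?thesis
    proof (rule zint_riemann[of _ e], fold \<kappa>_def)
      fix N :: nat and x w :: "nat \<Rightarrow> real"
      assume xw: "\<And>i. x i \<in> {-1..1}" "\<And>i. 0 \<le> w i" "(\<Sum>i<N. w i) = \<kappa>"
        and R: "\<And>g \<epsilon>. continuous_on {-1..1} g \<Longrightarrow>
         (\<And>s t. s \<in> {-1..1} \<Longrightarrow> t \<in> {-1..1} \<Longrightarrow> \<bar>s - t\<bar> \<le> \<delta> / 2 \<Longrightarrow> \<bar>g s - g t\<bar> \<le> \<epsilon>) \<Longrightarrow>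
         \<bar>zint (Suc e) g - (\<Sum>i<N. w i * g (x i))\<bar> \<le> \<epsilon> * \<kappa>"
      have left: "\<bar>K s y - K t y\<bar> \<le> \<epsilon>" and right: "\<bar>K y s - K y t\<bar> \<le> \<epsilon>"
        if "s \<in> {-1..1}" "t \<in> {-1..1}" "\<bar>s - t\<bar> \<le> \<delta> / 2" "y \<in> {-1..1}" for s t y
        using \<delta>(2)[of "(t, y)" "(s, y)"] \<delta>(2)[of "(y, t)" "(y, s)"] that \<delta>(1)
        by (simp_all add: dist_Pair_Pair dist_real_def)
      have "\<bar>zint (Suc e) (\<lambda>x'. zint (Suc e) (K x')) - zint (Suc e) (\<lambda>x'. \<Sum>j<N. w j * K x' (x j))\<bar>
          \<le> (\<epsilon> * \<kappa>) * \<kappa>"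
        unfolding \<kappa>_def
      proof (rule zint_diff_bound)
        show "continuous_on {-1..1} (\<lambda>x'. zint (Suc e) (K x'))"
          by (rule continuous_on_zint[OF K])
        show "continuous_on {-1..1} (\<lambda>x'. \<Sum>j<N. w j * K x' (x j))"
          by (intro continuous_intros continuous_on_section(2)[OF K] xw)
        show "\<bar>zint (Suc e) (K x') - (\<Sum>j<N. w j * K x' (x j))\<bar> \<le> \<epsilon> * zint (Suc e) (\<lambda>x. 1)"
          if "x' \<in> {-1..1}" for x'
          unfolding \<kappa>_def[symmetric]
          by (rule R[OF continuous_on_section(1)[OF K that]]) (rule right[OF _ _ _ that])
      qed
      moreover have "zint (Suc e) (\<lambda>x'. \<Sum>j<N. w j * K x' (x j)) = (\<Sum>j<N. w j * zint (Suc e) (\<lambda>x'. K x' (x j)))"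
        by (subst zint_sum) (auto simp: zint_cmult intro!: continuous_intros continuous_on_section(2)[OF K] xw)
      moreover have "\<bar>(\<Sum>j<N. w j * zint (Suc e) (\<lambda>x'. K x' (x j))) - (\<Sum>j<N. w j * (\<Sum>i<N. w i * K (x i) (x j)))\<bar>
          \<le> (\<Sum>j<N. w j * (\<epsilon> * \<kappa>))"
        unfolding sum_subtractf[symmetric] right_diff_distrib[symmetric]
      proof (intro order.trans[OF sum_abs] sum_mono)
        fix j
        have "\<bar>zint (Suc e) (\<lambda>x'. K x' (x j)) - (\<Sum>i<N. w i * K (x i) (x j))\<bar> \<le> \<epsilon> * \<kappa>"
          by (rule R[OF continuous_on_section(2)[OF K xw(1)]]) (rule left[OF _ _ _ xw(1)])
        then show "\<bar>w j * (zint (Suc e) (\<lambda>x'. K x' (x j)) - (\<Sum>i<N. w i * K (x i) (x j)))\<bar> \<le> w j * (\<epsilon> * \<kappa>)"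
          using xw(2)[of j] by (simp add: abs_mult mult_left_mono)
      qed
      moreover have "(\<Sum>j<N. w j * (\<epsilon> * \<kappa>)) = \<epsilon> * \<kappa> * \<kappa>"
        by (simp add: xw(3) flip: sum_distrib_right)
      moreover have "0 \<le> (\<Sum>j<N. w j * (\<Sum>i<N. w i * K (x i) (x j)))"
      proof -
        have "(\<Sum>j<N. w j * (\<Sum>i<N. w i * K (x i) (x j))) = (\<Sum>i<N. \<Sum>j<N. w i * w j * K (x i) (x j))"
          by (subst sum.swap) (simp add: sum_distrib_left mult_ac)
        then show ?thesis using pd[OF xw(1)] by simp
      qed
      ultimately show ?thesis by linarith
    qed
  qed
  note main = this
  show ?thesis
  proof (rule ccontr)
    define Z where "Z = zint (Suc e) (\<lambda>x. zint (Suc e) (K x))"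
    assume "\<not> 0 \<le> zint (Suc e) (\<lambda>x. zint (Suc e) (K x))"
    then have "Z < 0" by (simp add: Z_def)
    \<comment> \<open>For this \<open>\<epsilon>\<close> the lower bound
      \<open>-(2 * \<epsilon> * \<kappa> * \<kappa>)\<close> equals \<open>Z / 2\<close>, which
      exceeds a negative \<open>Z\<close>.\<close>
    then have "- Z / (4 * \<kappa> * \<kappa>) > 0" using \<kappa> by (intro divide_pos_pos mult_pos_pos) auto
    from main[OF this] have "Z / 2 \<le> Z" using \<kappa> by (simp add: Z_def)
    then show False using \<open>Z < 0\<close> by simp
  qed
qed

text \<open>
  Points of \<open>S\<^sup>e\<close> are coordinate functions on \<open>{..e}\<close> rather than vectors, to allow induction on \<open>e\<close>.
\<close>

definition psd :: "nat \<Rightarrow> (real \<Rightarrow> real) \<Rightarrow> bool" where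
  "psd e F \<longleftrightarrow> continuous_on {-1..1} F \<and>
     (\<forall>(m::nat) (\<xi> :: nat \<Rightarrow> nat \<Rightarrow> real) b. (\<forall>i<m. (\<Sum>t\<le>e. (\<xi> i t)\<^sup>2) = 1) \<longrightarrow>
        0 \<le> (\<Sum>i<m. \<Sum>j<m. b i * b j * F (\<Sum>t\<le>e. \<xi> i t * \<xi> j t)))"

lemma psdD:
  fixes m :: nat
  assumes "psd e F"
  shows "continuous_on {-1..1} F"
    and "(\<And>i. i < m \<Longrightarrow> (\<Sum>t\<le>e. (\<xi> i t)\<^sup>2) = 1) \<Longrightarrow>
      0 \<le> (\<Sum>i<m. \<Sum>j<m. b i * b j * F (\<Sum>t\<le>e. \<xi> i t * \<xi> j t))"
proof -
  show "continuous_on {-1..1} F" using assms by (simp add: psd_def)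
  show "0 \<le> (\<Sum>i<m. \<Sum>j<m. b i * b j * F (\<Sum>t\<le>e. \<xi> i t * \<xi> j t))"
    if "\<And>i. i < m \<Longrightarrow> (\<Sum>t\<le>e. (\<xi> i t)\<^sup>2) = 1"
    by (rule assms[unfolded psd_def, THEN conjunct2, rule_format]) (rule that)
qed

lemma psd_finite:
  fixes \<xi> :: "'i \<Rightarrow> nat \<Rightarrow> real"
  assumes "psd e F" "finite I" "\<And>i. i \<in> I \<Longrightarrow> (\<Sum>t\<le>e. (\<xi> i t)\<^sup>2) = 1"
  shows "0 \<le> (\<Sum>i\<in>I. \<Sum>j\<in>I. b i * b j * F (\<Sum>t\<le>e. \<xi> i t * \<xi> j t))"
proof -
  obtain h where h: "bij_betw h {..<card I} I"
    using ex_bij_betw_nat_finite[OF assms(2)] by (auto simp: atLeast0LessThan)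
  have "0 \<le> (\<Sum>i<card I. \<Sum>j<card I. b (h i) * b (h j) * F (\<Sum>t\<le>e. \<xi> (h i) t * \<xi> (h j) t))"
  proof (rule psdD(2)[OF assms(1)])
    fix i assume "i < card I"
    then have "h i \<in> I" using bij_betwE[OF h] by auto
    then show "(\<Sum>t\<le>e. (\<xi> (h i) t)\<^sup>2) = 1" by (rule assms(3))
  qed
  also have "\<dots> = (\<Sum>i<card I. \<Sum>j\<in>I. b (h i) * b j * F (\<Sum>t\<le>e. \<xi> (h i) t * \<xi> j t))"
    by (rule sum.cong[OF refl]) (rule sum.reindex_bij_betw[OF h])
  also have "\<dots> = (\<Sum>i\<in>I. \<Sum>j\<in>I. b i * b j * F (\<Sum>t\<le>e. \<xi> i t * \<xi> j t))"
    by (rule sum.reindex_bij_betw[OF h])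
  finally show ?thesis .
qed

lemma continuous_on_zadd:
  assumes "continuous_on {-1..1} F" "x \<in> {-1..1}" "y \<in> {-1..1}"
  shows "continuous_on {-1..1} (\<lambda>r. F (zadd x y r))"
proof (rule continuous_on_compose2[OF assms(1)])
  show "continuous_on {-1..1} (zadd x y)" by (auto simp: zadd_def[abs_def] intro!: continuous_intros)
  show "zadd x y ` {-1..1} \<subseteq> {-1..1}" using zadd_mem assms(2,3) by blast
qed

lemma continuous_on_zint_zadd:
  assumes "continuous_on {-1..1} F"
  shows "continuous_on ({-1..1} \<times> {-1..1}) (\<lambda>(x, y). zint e (\<lambda>r. F (zadd x y r)))"
proof -
  have "continuous_on (({-1..1} \<times> {-1..1}) \<times> {-1..1}) (\<lambda>p. F (zadd (fst (fst p)) (snd (fst p)) (snd p)))"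
  proof (rule continuous_on_compose2[OF assms])
    show "continuous_on (({-1..1} \<times> {-1..1}) \<times> {-1..1}) (\<lambda>p. zadd (fst (fst p)) (snd (fst p)) (snd p))"
      unfolding zadd_def by (intro continuous_intros)
    show "(\<lambda>p. zadd (fst (fst p)) (snd (fst p)) (snd p)) ` (({-1..1} \<times> {-1..1}) \<times> {-1..1}) \<subseteq> {-1..1}"
      using zadd_mem by auto
  qed
  then show ?thesis
    unfolding case_prod_beta by (intro continuous_on_zint) (simp add: case_prod_beta)
qed

text \<open>Test \<open>F\<close> at the points of height \<open>x i\<close> above every equatorial
  point \<open>\<xi> p\<close>, with product weights; their scalar products are values of
  \<open>zadd\<close>. Summing over the heights leaves a quadratic form on the lower sphere.\<close>

lemma psd_zadd:
  fixes x b :: "nat \<Rightarrow> real"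
  assumes "psd (Suc e) F" "\<And>i. x i \<in> {-1..1}"
  shows "psd e (\<lambda>r. \<Sum>i<N. \<Sum>j<N. b i * b j * F (zadd (x i) (x j) r))"
  unfolding psd_def
proof (intro conjI allI impI)
  have "continuous_on {-1..1} F" using assms(1) by (rule psdD)
  then show "continuous_on {-1..1} (\<lambda>r. \<Sum>i<N. \<Sum>j<N. b i * b j * F (zadd (x i) (x j) r))"
    using assms(2) by (intro continuous_intros continuous_on_zadd)
  fix m :: nat and \<xi> :: "nat \<Rightarrow> nat \<Rightarrow> real" and a :: "nat \<Rightarrow> real"
  assume \<xi>: "\<forall>i<m. (\<Sum>t\<le>e. (\<xi> i t)\<^sup>2) = 1"
  define s where "s i = sqrt (1 - (x i)\<^sup>2)" for i
  define \<eta> where "\<eta> = (\<lambda>(p, i) t. if t \<le> e then s i * \<xi> p t else x i)"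
  have dot: "(\<Sum>t\<le>Suc e. \<eta> (p, i) t * \<eta> (q, j) t) = zadd (x i) (x j) (\<Sum>t\<le>e. \<xi> p t * \<xi> q t)" for p q i j
    by (simp add: \<eta>_def zadd_def s_def sum_distrib_left mult_ac)
  have "(\<Sum>t\<le>Suc e. (\<eta> v t)\<^sup>2) = 1" if v_mem: "v \<in> {..<m} \<times> {..<N}" for v
  proof -
    obtain p i where v: "v = (p, i)" "p < m" using v_mem by auto
    have "(s i)\<^sup>2 = 1 - (x i)\<^sup>2" unfolding s_def by (rule sqrt_1_minus_sq[OF assms(2)])
    moreover have "(\<Sum>t\<le>e. (\<xi> p t)\<^sup>2) = 1" using \<xi> v by blast
    ultimately show ?thesis
      using dot[of p i p i] by (simp add: v zadd_def flip: power2_eq_square s_def)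
  qed
  then have "0 \<le> (\<Sum>v\<in>{..<m} \<times> {..<N}. \<Sum>v'\<in>{..<m} \<times> {..<N}.
      (a (fst v) * b (snd v)) * (a (fst v') * b (snd v')) * F (\<Sum>t\<le>Suc e. \<eta> v t * \<eta> v' t))"
    by (intro psd_finite[OF assms(1)]) auto
  also have "\<dots> = (\<Sum>p<m. \<Sum>i<N. \<Sum>q<m. \<Sum>j<N. a p * b i * (a q * b j) * F (zadd (x i) (x j) (\<Sum>t\<le>e. \<xi> p t * \<xi> q t)))"
    by (simp only: sum.cartesian_product' dot fst_conv snd_conv)
  also have "\<dots> = (\<Sum>p<m. \<Sum>q<m. a p * a q * (\<Sum>i<N. \<Sum>j<N. b i * b j * F (zadd (x i) (x j) (\<Sum>t\<le>e. \<xi> p t * \<xi> q t))))"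
    by (rule sum.cong[OF refl], rule trans[OF sum.swap]) (simp add: sum_distrib_left mult_ac)
  finally show "0 \<le> (\<Sum>p<m. \<Sum>q<m. a p * a q * (\<Sum>i<N. \<Sum>j<N. b i * b j * F (zadd (x i) (x j) (\<Sum>t\<le>e. \<xi> p t * \<xi> q t))))" .
qed

lemma nonpos_if_le_mult:
  fixes x C :: real
  assumes "\<And>\<epsilon>. 0 < \<epsilon> \<Longrightarrow> x \<le> \<epsilon> * C"
  shows "x \<le> 0"
proof (rule ccontr)
  assume "\<not> x \<le> 0"
  define \<epsilon> where "\<epsilon> = x / (2 * (\<bar>C\<bar> + 1))"
  have "0 < \<epsilon>" using \<open>\<not> x \<le> 0\<close> by (simp add: \<epsilon>_def)
  then have "x \<le> \<epsilon> * (\<bar>C\<bar> + 1)"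
    using assms[of \<epsilon>] by (intro order.trans[OF assms mult_left_mono]) auto
  also have "\<dots> = x / 2" by (simp add: \<epsilon>_def field_simps)
  finally show False using \<open>\<not> x \<le> 0\<close> by simp
qed

lemma poly_approximation:
  assumes "continuous_on {-1..1} F" "\<epsilon> > 0"
  obtains p :: "real poly" where "\<And>x. x \<in> {-1..1} \<Longrightarrow> \<bar>F x - poly p x\<bar> \<le> \<epsilon>"
proof -
  obtain g where g: "real_polynomial_function g" "\<And>x. x \<in> {-1..1} \<Longrightarrow> \<bar>F x - g x\<bar> < \<epsilon>"
    using Stone_Weierstrass_real_polynomial_function[OF _ assms] by blast
  obtain a n where "g = (\<lambda>x. \<Sum>i\<le>n. a i * x ^ i)"
    using g(1) by (auto simp: real_polynomial_function_iff_sum)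
  then have "poly (\<Sum>i\<le>n. monom (a i) i) x = g x" for x by (simp add: poly_sum poly_monom)
  then show ?thesis using g(2) by (intro that[of "\<Sum>i\<le>n. monom (a i) i"]) (auto simp: less_imp_le)
qed

text \<open>The convolution operator with zonal kernel \<^term>\<open>F\<close> is diagonal in the Gegenbauer basis (Funk--Hecke).\<close>

lemma zint_zint_zadd_geg:
  fixes k e :: nat
  assumes F: "continuous_on {-1..1} F"
  defines "g \<equiv> poly (geg k (Suc e))"
  shows "zint (Suc e) (\<lambda>x. zint (Suc e) (\<lambda>y. g x * g y * zint e (\<lambda>r. F (zadd x y r))))
    = zint e (\<lambda>r. 1) * geg_norm k (Suc e) * zint (Suc e) (\<lambda>x. F x * g x)" (is "?T F = ?c * ?R F")
proof -
  define \<kappa> where "\<kappa> = zint e (\<lambda>r. 1)"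
  define \<kappa>' where "\<kappa>' = zint (Suc e) (\<lambda>r. 1)"
  have cont_g: "continuous_on A g" for A unfolding g_def by (intro continuous_intros)
  have g1: "\<bar>g x\<bar> \<le> 1" if "x \<in> {-1..1}" for x unfolding g_def using that by (rule geg_bound) simp
  have cont_K: "continuous_on ({-1..1} \<times> {-1..1}) (\<lambda>(x, y). g x * g y * zint e (\<lambda>r. H (zadd x y r)))"
    if "continuous_on {-1..1} H" for H
    using continuous_on_zint_zadd[OF that, of e] unfolding case_prod_beta
    by (intro continuous_intros continuous_on_compose2[OF cont_g]) auto
  have poly: "?T (poly p) = ?c * ?R (poly p)" for p
  proof -
    \<comment> \<open>At least \<open>k\<close>, so that the term \<open>k\<close> occurs in the
      expansion even if \<open>p\<close> has smaller degree.\<close>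
    define n where "n = max k (degree p)"
    define a where "a j = pint (Suc e) (p * geg j (Suc e)) / geg_norm j (Suc e)" for j
    have p: "p = (\<Sum>j\<le>n. smult (a j) (geg j (Suc e)))"
      unfolding a_def by (rule poly_geg_expansion) (auto simp: n_def)
    have inner: "zint e (\<lambda>r. poly p (zadd x y r)) = (\<Sum>j\<le>n. a j * \<kappa> * poly (geg j (Suc e)) x * poly (geg j (Suc e)) y)"
      if "x \<in> {-1..1}" "y \<in> {-1..1}" for x y
    proof -
      have "zint e (\<lambda>r. poly p (zadd x y r)) = zint e (\<lambda>r. \<Sum>j\<le>n. a j * poly (geg j (Suc e)) (zadd x y r))"
        by (subst p) (simp add: poly_sum)
      also have "\<dots> = (\<Sum>j\<le>n. a j * zint e (\<lambda>r. poly (geg j (Suc e)) (zadd x y r)))"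
        using that by (subst zint_sum) (auto simp: zint_cmult intro!: continuous_intros continuous_on_zadd)
      finally show ?thesis using that by (simp add: geg_product_formula \<kappa>_def mult_ac)
    qed
    have gg: "zint (Suc e) (\<lambda>y. g y * poly (geg j (Suc e)) y) = (if j = k then geg_norm k (Suc e) else 0)" for j
      using pint_geg_geg[of "Suc e" k j] by (auto simp: pint_def g_def)
    have "zint (Suc e) (\<lambda>y. g x * g y * zint e (\<lambda>r. poly p (zadd x y r))) = a k * \<kappa> * geg_norm k (Suc e) * (g x * g x)"
      if x: "x \<in> {-1..1}" for x
    proof -
      have "zint (Suc e) (\<lambda>y. g x * g y * zint e (\<lambda>r. poly p (zadd x y r)))
          = zint (Suc e) (\<lambda>y. \<Sum>j\<le>n. (g x * a j * \<kappa> * poly (geg j (Suc e)) x) * (g y * poly (geg j (Suc e)) y))"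
        by (rule zint_cong) (simp add: inner[OF x] sum_distrib_left mult_ac)
      also have "\<dots> = (\<Sum>j\<le>n. (g x * a j * \<kappa> * poly (geg j (Suc e)) x) * zint (Suc e) (\<lambda>y. g y * poly (geg j (Suc e)) y))"
        by (subst zint_sum) (auto simp only: zint_cmult intro!: continuous_intros cont_g)
      also have "\<dots> = (\<Sum>j\<le>n. if j = k then a k * \<kappa> * geg_norm k (Suc e) * (g x * g x) else 0)"
        by (intro sum.cong) (auto simp: gg[unfolded g_def] g_def)
      finally show ?thesis by (simp add: n_def)
    qed
    then have "?T (poly p) = zint (Suc e) (\<lambda>x. a k * \<kappa> * geg_norm k (Suc e) * (g x * g x))"
      by (rule zint_cong)
    also have "\<dots> = a k * \<kappa> * geg_norm k (Suc e) * geg_norm k (Suc e)"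
      by (simp only: zint_cmult gg[of k, folded g_def] if_True simp_thms)
    also have "\<dots> = ?c * ?R (poly p)"
      using geg_norm_pos[of "Suc e" k] by (simp add: a_def \<kappa>_def pint_def g_def)
    finally show ?thesis .
  qed
  \<comment> \<open>Both sides change by at most a constant times \<open>\<epsilon>\<close> when
    \<open>F\<close> changes by \<open>\<epsilon>\<close> in supremum norm, so Weierstrass
    approximation extends the identity from polynomials.\<close>
  have "\<bar>?T F - ?c * ?R F\<bar> \<le> \<epsilon> * (\<kappa> * \<kappa>' * \<kappa>' + ?c * \<kappa>')" if \<epsilon>: "\<epsilon> > 0" for \<epsilon>
  proof -
    obtain p where p: "\<And>x. x \<in> {-1..1} \<Longrightarrow> \<bar>F x - poly p x\<bar> \<le> \<epsilon>"
      using poly_approximation[OF F \<epsilon>] by blast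
    have cp: "continuous_on {-1..1} (poly p)" by (intro continuous_intros)
    have "\<bar>?R F - ?R (poly p)\<bar> \<le> \<epsilon> * \<kappa>'"
      unfolding \<kappa>'_def
    proof (rule zint_diff_bound)
      fix x :: real assume x: "x \<in> {-1..1}"
      have "\<bar>F x - poly p x\<bar> * \<bar>g x\<bar> \<le> \<epsilon> * 1" using p[OF x] g1[OF x] \<epsilon> by (intro mult_mono) auto
      then show "\<bar>F x * g x - poly p x * g x\<bar> \<le> \<epsilon>" by (simp add: abs_mult flip: left_diff_distrib)
    qed (auto intro!: continuous_intros F cont_g)
    then have "?c * \<bar>?R F - ?R (poly p)\<bar> \<le> ?c * (\<epsilon> * \<kappa>')"
      using zint_one_pos[of e] geg_norm_pos[of "Suc e" k] by (intro mult_left_mono) auto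
    then have 1: "\<bar>?c * ?R F - ?c * ?R (poly p)\<bar> \<le> ?c * (\<epsilon> * \<kappa>')"
      using zint_one_pos[of e] geg_norm_pos[of "Suc e" k] by (simp add: abs_mult flip: right_diff_distrib)
    have "\<bar>?T F - ?T (poly p)\<bar> \<le> (\<epsilon> * \<kappa> * \<kappa>') * \<kappa>'"
      unfolding \<kappa>'_def
    proof (rule zint_diff_bound)
      fix x :: real assume x: "x \<in> {-1..1}"
      show "\<bar>zint (Suc e) (\<lambda>y. g x * g y * zint e (\<lambda>r. F (zadd x y r)))
          - zint (Suc e) (\<lambda>y. g x * g y * zint e (\<lambda>r. poly p (zadd x y r)))\<bar> \<le> \<epsilon> * \<kappa> * zint (Suc e) (\<lambda>r. 1)"
      proof (rule zint_diff_bound)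
        fix y :: real assume y: "y \<in> {-1..1}"
        have "\<bar>zint e (\<lambda>r. F (zadd x y r)) - zint e (\<lambda>r. poly p (zadd x y r))\<bar> \<le> \<epsilon> * \<kappa>"
          unfolding \<kappa>_def using x y zadd_mem
          by (intro zint_diff_bound continuous_on_zadd F cp) (auto intro!: p)
        moreover have "\<bar>g x * g y\<bar> \<le> 1 * 1" unfolding abs_mult using g1[OF x] g1[OF y] by (intro mult_mono) auto
        ultimately have "\<bar>g x * g y\<bar> * \<bar>zint e (\<lambda>r. F (zadd x y r)) - zint e (\<lambda>r. poly p (zadd x y r))\<bar> \<le> 1 * (\<epsilon> * \<kappa>)"
          by (intro mult_mono) auto
        then show "\<bar>g x * g y * zint e (\<lambda>r. F (zadd x y r)) - g x * g y * zint e (\<lambda>r. poly p (zadd x y r))\<bar> \<le> \<epsilon> * \<kappa>"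
          by (simp only: abs_mult[symmetric] right_diff_distrib[symmetric] mult_1_left)
      qed (use continuous_on_section(1)[OF cont_K[OF F] x] continuous_on_section(1)[OF cont_K[OF cp] x] in auto)
    qed (auto intro!: continuous_on_zint cont_K F cp)
    then show ?thesis using 1 poly[of p] by (simp add: algebra_simps)
  qed
  then have "\<bar>?T F - ?c * ?R F\<bar> \<le> 0" by (rule nonpos_if_le_mult)
  then show ?thesis by simp
qed

text \<open>Positivity of the plain mean in dimension \<open>e\<close> gives positivity of all
  coefficients in dimension \<open>e + 1\<close>: averaging over the equator yields a positive
  semidefinite kernel in the heights, and its double integral against \<open>g\<close> is a positive
  multiple of the integral in question.\<close>

lemma zint_mult_geg_nonneg_step:
  assumes IH: "\<And>H. psd e H \<Longrightarrow> 0 \<le> zint e H" and F: "psd (Suc e) F"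
  shows "0 \<le> zint (Suc e) (\<lambda>x. F x * poly (geg k (Suc e)) x)"
proof -
  define g where "g = poly (geg k (Suc e))"
  have cont: "continuous_on {-1..1} F" using F by (rule psdD)
  have cont_g: "continuous_on A g" for A unfolding g_def by (intro continuous_intros)
  have "0 \<le> zint (Suc e) (\<lambda>x. zint (Suc e) (\<lambda>y. g x * g y * zint e (\<lambda>r. F (zadd x y r))))"
  proof (rule zint_zint_nonneg)
    show "continuous_on ({-1..1} \<times> {-1..1}) (\<lambda>(x, y). g x * g y * zint e (\<lambda>r. F (zadd x y r)))"
      using continuous_on_zint_zadd[OF cont, of e] unfolding case_prod_beta
      by (intro continuous_intros continuous_on_compose2[OF cont_g]) auto
    fix N :: nat and x w :: "nat \<Rightarrow> real" assume x: "\<And>i. x i \<in> {-1..1}"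
    let ?b = "\<lambda>i. w i * g (x i)"
    have "0 \<le> zint e (\<lambda>r. \<Sum>i<N. \<Sum>j<N. ?b i * ?b j * F (zadd (x i) (x j) r))"
      by (intro IH psd_zadd F x)
    also have "\<dots> = (\<Sum>i<N. \<Sum>j<N. ?b i * ?b j * zint e (\<lambda>r. F (zadd (x i) (x j) r)))"
      by (simp add: zint_sum zint_cmult continuous_intros continuous_on_zadd cont x del: atLeastAtMost_iff)
    finally show "0 \<le> (\<Sum>i<N. \<Sum>j<N. w i * w j * (g (x i) * g (x j) * zint e (\<lambda>r. F (zadd (x i) (x j) r))))"
      by (simp add: mult_ac)
  qed
  then have "0 \<le> zint e (\<lambda>r. 1) * geg_norm k (Suc e) * zint (Suc e) (\<lambda>x. F x * g x)"
    unfolding g_def zint_zint_zadd_geg[OF cont] .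
  moreover have "0 < zint e (\<lambda>r. 1) * geg_norm k (Suc e)"
    using zint_one_pos[of e] geg_norm_pos[of "Suc e" k] by simp
  ultimately show ?thesis by (simp add: zero_le_mult_iff g_def)
qed

text \<open>On the two points \<open>1\<close> and \<open>-1\<close> with equal weights the
  quadratic form is \<open>2 * (F 1 + F (-1))\<close>. The induction step is the case
  \<open>k = 0\<close>, where the polynomial is \<open>1\<close>.\<close>

lemma psd_zint_nonneg: "psd e F \<Longrightarrow> 0 \<le> zint e F"
proof (induction e arbitrary: F)
  case 0
  have "0 \<le> (\<Sum>i<2. \<Sum>j<2. 1 * 1 * F (\<Sum>t\<le>(0::nat). (-1) ^ i * (-1) ^ j))"
    by (rule psd_finite[OF 0, where \<xi>="\<lambda>i t. (-1) ^ i" and b="\<lambda>_. 1"])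
      (auto simp: power2_eq_square simp flip: power_mult_distrib)
  then show ?case by (simp add: zint_0 numeral_2_eq_2)
next
  case (Suc e)
  show ?case using zint_mult_geg_nonneg_step[OF Suc.IH Suc.prems, of 0] by simp
qed

theorem zint_mult_geg_nonneg:
  assumes "psd d F" "d > 0"
  shows "0 \<le> zint d (\<lambda>x. F x * poly (geg k d) x)"
  using assms zint_mult_geg_nonneg_step[OF psd_zint_nonneg] by (cases d) auto

subsection \<open>The Gegenbauer expansion\<close>

definition gcoef :: "nat \<Rightarrow> nat \<Rightarrow> (real \<Rightarrow> real) \<Rightarrow> real" where
  "gcoef k d F = zint d (\<lambda>x. F x * poly (geg k d) x) / geg_norm k d"

lemma gcoef_add:
  assumes "continuous_on {-1..1} F" "continuous_on {-1..1} H"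
  shows "gcoef k d (\<lambda>x. F x + H x) = gcoef k d F + gcoef k d H"
  using assms by (simp add: gcoef_def distrib_right zint_add continuous_intros add_divide_distrib)

lemma gcoef_cmult: "gcoef k d (\<lambda>x. c * F x) = c * gcoef k d F"
  using zint_cmult[of d c "\<lambda>x. F x * poly (geg k d) x"] by (simp add: gcoef_def mult.assoc)

lemma gcoef_nonneg: "psd d F \<Longrightarrow> d > 0 \<Longrightarrow> 0 \<le> gcoef k d F"
  by (simp add: gcoef_def zint_mult_geg_nonneg geg_norm_pos less_imp_le)

lemma pint_mult_1_minus_sq: 
  assumes "d > 0" shows "pint (d + 2) p = pint d (p * [:1, 0, -1:])"
proof -
  obtain e where d: "d = Suc e" using assms by (cases d) auto
  have "poly p (cos t) * sin t ^ Suc (Suc e) = poly (p * [:1, 0, -1:]) (cos t) * sin t ^ e" for t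
  proof -
    have "1 - cos t * cos t = sin t * sin t" using sin_squared_eq[of t] by (simp add: power2_eq_square)
    moreover have "poly (p * [:1, 0, -1:]) y = poly p y * (1 - y * y)" for y
      by (simp add: algebra_simps)
    ultimately show ?thesis by (simp only: power_Suc mult_ac)
  qed
  then show ?thesis unfolding d pint_def add_2_eq_Suc' zint_Suc by presburger
qed

lemma pint_mono: "(\<And>x. x \<in> {-1..1} \<Longrightarrow> poly p x \<le> poly q x) \<Longrightarrow> pint d p \<le> pint d q"
  unfolding pint_def by (rule zint_mono) (auto intro!: continuous_intros)

lemma pint_power_pos:
  assumes "d > 0"
  shows "0 < pint d ([:1, 1:] ^ m)"
proof -
  have "0 \<le> pint d ([:1, 1:] ^ m)" by (rule pint_nonneg) (simp add: poly_power)
  moreover have "pint d ([:1, 1:] ^ m) \<noteq> 0"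
  proof
    assume 0: "pint d ([:1, 1:] ^ m) = 0"
    obtain e where d: "d = Suc e" using assms by (cases d) auto
    have "poly ([:1, 1:] ^ m) 0 = (0::real)"
      using 0 unfolding d pint_def
      by (intro zint_eq_0D[of "poly ([:1, 1:] ^ m)" e]) (auto simp: poly_power intro!: continuous_intros)
    then show False by (simp add: poly_power)
  qed
  ultimately show ?thesis by simp
qed

text \<open>
  The weights \<open>(1 + x)\<^sup>m\<close> concentrate at \<open>x = 1\<close> and have nonnegative coefficients
  (\<open>pint_power_mult_geg_nonneg\<close>), so they serve as a summability kernel bounding the coefficient sums.
\<close>

lemma pint_power_concentrates:
  assumes "d > 0" "m > 0"
  shows "pint d ([:1, 1:] ^ m * [:1, -1:]) \<le> real d / real m * pint d ([:1, 1:] ^ m)"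
proof -
  obtain n where m: "m = Suc n" using assms(2) by (cases m) auto
  \<comment> \<open>The polynomial of degree one is \<open>x\<close>. Integrating by parts,
    \<open>m\<close> times the integral of \<open>(1 + x) ^ m * (1 - x)\<close> is \<open>d\<close>
    times that of \<open>(1 + x) ^ m * x\<close>.\<close>
  have "geg (Suc 0) d = [:0, 1:]" by (simp add: geg.simps(2))
  then have "pint d ([:1, 1:] ^ m * [:0, 1:]) = pint (d + 2) (pderiv ([:1, 1:] ^ m)) / real d"
    using pint_mult_geg_Suc[OF assms(1), of "[:1, 1:] ^ m" 0] by (simp del: mult_pCons_right)
  also have "pderiv ([:1, 1:] ^ m) = smult (real m) ([:1, 1:] ^ n :: real poly)"
    unfolding m pderiv_power_Suc by (simp add: pderiv_pCons)
  also have "pint (d + 2) (smult (real m) ([:1, 1:] ^ n)) = real m * pint d ([:1, 1:] ^ n * [:1, 0, -1:])"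
    by (simp only: pint_smult pint_mult_1_minus_sq[OF assms(1)])
  also have "[:1, 0, -1:] = [:1, 1:] * [:1, -1 :: real:]" by simp
  also have "[:1, 1:] ^ n * ([:1, 1:] * [:1, -1:]) = [:1, 1:] ^ m * [:1, -1 :: real:]"
    by (simp only: m power_Suc mult_ac)
  finally have "real m * pint d ([:1, 1:] ^ m * [:1, -1:]) = real d * pint d ([:1, 1:] ^ m * [:0, 1:])"
    using assms(1) by (simp add: field_simps del: mult_pCons_right)
  also have "\<dots> \<le> real d * pint d ([:1, 1:] ^ m)"
  proof (intro mult_left_mono pint_mono)
    fix x :: real assume "x \<in> {-1..1}"
    then show "poly ([:1, 1:] ^ m * [:0, 1:]) x \<le> poly ([:1, 1:] ^ m) x"
      using mult_left_mono[of x 1 "(1 + x) ^ m"] by (simp add: poly_power mult_ac)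
  qed simp
  finally show ?thesis using assms(2) by (simp add: field_simps del: mult_pCons_right)
qed

lemma poly_bounded_on_interval:
  obtains C where "\<And>x. x \<in> {-1..1::real} \<Longrightarrow> \<bar>poly p x\<bar> \<le> C"
proof -
  have "compact (poly p ` {-1..1})" by (intro compact_continuous_image continuous_intros) auto
  then have "bounded (poly p ` {-1..1})" by (rule compact_imp_bounded)
  then obtain C where "\<forall>y\<in>poly p ` {-1..1}. norm y \<le> C" by (auto simp: bounded_iff)
  then show ?thesis by (intro that[of C]) auto
qed

text \<open>\<open>1 - geg k d\<close> vanishes at \<open>1\<close> and so contains the factor
  \<open>1 - x\<close>; concentration then makes the error of order \<open>1 / m\<close>.\<close>

lemma pint_power_mult_geg_tendsto:
  assumes "d > 0"
  shows "(\<lambda>m. pint d ([:1, 1:] ^ m * geg k d) / pint d ([:1, 1:] ^ m)) \<longlonglongrightarrow> 1"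
proof -
  have "poly (1 - geg k d) 1 = 0" by simp
  then obtain q where "1 - geg k d = [:-1, 1:] * q" by (metis dvd_def poly_eq_0_iff_dvd)
  then have q: "1 - geg k d = [:1, -1:] * (- q)" by simp
  obtain C where C: "\<And>x. x \<in> {-1..1} \<Longrightarrow> \<bar>poly q x\<bar> \<le> C"
    using poly_bounded_on_interval by blast
  let ?I = "\<lambda>m. pint d ([:1, 1:] ^ m)"
  have bound: "\<bar>pint d ([:1, 1:] ^ m * geg k d) / ?I m - 1\<bar> \<le> C * real d / real m" if "m > 0" for m
  proof -
    have "?I m - pint d ([:1, 1:] ^ m * geg k d) = pint d ([:1, 1:] ^ m * ([:1, -1:] * (- q)))"
      unfolding q[symmetric] right_diff_distrib
      using pint_add[of d "[:1, 1:] ^ m * 1 - [:1, 1:] ^ m * geg k d" "[:1, 1:] ^ m * geg k d"] by simp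
    also have "\<bar>\<dots>\<bar> \<le> pint d (smult C ([:1, 1:] ^ m * [:1, -1:]))"
    proof -
      have *: "\<bar>(1 + x) ^ m * ((1 - x) * poly q x)\<bar> \<le> C * ((1 + x) ^ m * (1 - x))" if "x \<in> {-1..1}" for x
      proof -
        have "((1 + x) ^ m * (1 - x)) * \<bar>poly q x\<bar> \<le> ((1 + x) ^ m * (1 - x)) * C"
          using C[OF that] that by (intro mult_left_mono) auto
        then show ?thesis using that by (simp add: abs_mult mult_ac power_abs)
      qed
      have "pint d ([:1, 1:] ^ m * ([:1, -1:] * (- q))) \<le> pint d (smult C ([:1, 1:] ^ m * [:1, -1:]))"
        "pint d (smult (-1) ([:1, 1:] ^ m * ([:1, -1:] * (- q)))) \<le> pint d (smult C ([:1, 1:] ^ m * [:1, -1:]))"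
        using * by (intro pint_mono; fastforce simp: poly_power algebra_simps abs_le_iff)+
      then show ?thesis unfolding pint_smult[of d "-1"] by linarith
    qed
    also have "\<dots> \<le> C * (real d / real m * ?I m)"
    proof -
      have "0 \<le> C" using C[of 0] by auto
      then show ?thesis
        unfolding pint_smult using pint_power_concentrates[OF assms that] by (intro mult_left_mono)
    qed
    finally have "\<bar>pint d ([:1, 1:] ^ m * geg k d) - ?I m\<bar> \<le> C * real d / real m * ?I m"
      by (simp add: abs_minus_commute)
    moreover have "pint d ([:1, 1:] ^ m * geg k d) / ?I m - 1 = (pint d ([:1, 1:] ^ m * geg k d) - ?I m) / ?I m"
      using pint_power_pos[OF assms, of m] by (simp add: diff_divide_distrib)
    ultimately show ?thesis
      using pint_power_pos[OF assms, of m] by (simp add: pos_divide_le_eq)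
  qed
  have "(\<lambda>m. pint d ([:1, 1:] ^ m * geg k d) / ?I m - 1) \<longlonglongrightarrow> 0"
  proof (rule Lim_null_comparison)
    show "\<forall>\<^sub>F m in sequentially. norm (pint d ([:1, 1:] ^ m * geg k d) / ?I m - 1) \<le> C * real d / real m"
      using eventually_gt_at_top[of 0] by eventually_elim (use bound in simp)
    show "(\<lambda>m. C * real d / real m) \<longlonglongrightarrow> 0" by (rule lim_const_over_n)
  qed
  then show ?thesis by (simp only: LIM_zero_iff)
qed

text \<open>Pairing \<open>F\<close> with \<open>(1 + x) ^ m\<close> multiplies its coefficients by
  nonnegative factors that tend to \<open>1\<close> after division by the mass of the kernel, while
  the pairing is at most \<open>B\<close> times that mass. With \<open>N\<close> fixed, the limit in
  \<open>m\<close> passes through the finite sum.\<close>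

lemma sum_gcoef_le:
  assumes "psd d F" "d > 0" "\<And>x. x \<in> {-1..1} \<Longrightarrow> \<bar>F x\<bar> \<le> B"
  shows "(\<Sum>k<N. gcoef k d F) \<le> B"
proof (rule LIMSEQ_le_const2)
  let ?r = "\<lambda>k m. pint d ([:1, 1:] ^ m * geg k d) / pint d ([:1, 1:] ^ m)"
  have "(\<lambda>m. \<Sum>k<N. ?r k m * gcoef k d F) \<longlonglongrightarrow> (\<Sum>k<N. 1 * gcoef k d F)"
    by (intro tendsto_sum tendsto_mult pint_power_mult_geg_tendsto assms(2) tendsto_const)
  then show "(\<lambda>m. \<Sum>k<N. ?r k m * gcoef k d F) \<longlonglongrightarrow> (\<Sum>k<N. gcoef k d F)" by simp
  have "(\<Sum>k<N. ?r k m * gcoef k d F) \<le> B" if "m \<ge> N" for m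
  proof -
    define P :: "real poly" where "P = [:1, 1:] ^ m"
    have cont: "continuous_on {-1..1} F" using assms(1) by (rule psdD)
    have deg: "degree P \<le> m" using degree_power_le[of "[:1, 1:] :: real poly" m] by (simp add: P_def)
    define c where "c k = pint d (P * geg k d) / geg_norm k d" for k
    have "zint d (\<lambda>x. F x * poly P x) = zint d (\<lambda>x. \<Sum>k\<le>m. c k * (F x * poly (geg k d) x))"
      unfolding c_def
      by (subst poly_geg_expansion[OF assms(2) deg]) (simp add: poly_sum sum_distrib_left mult_ac)
    also have "\<dots> = (\<Sum>k\<le>m. c k * zint d (\<lambda>x. F x * poly (geg k d) x))"
      by (subst zint_sum) (auto simp only: zint_cmult finite_atMost intro!: continuous_intros cont)
    also have "\<dots> = (\<Sum>k\<le>m. pint d (P * geg k d) * gcoef k d F)"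
      by (simp add: c_def gcoef_def)
    finally have *: "(\<Sum>k\<le>m. pint d (P * geg k d) * gcoef k d F) = zint d (\<lambda>x. F x * poly P x)" ..
    have "(\<Sum>k<N. pint d (P * geg k d) * gcoef k d F) \<le> (\<Sum>k\<le>m. pint d (P * geg k d) * gcoef k d F)"
      using that assms(1,2)
      by (intro sum_mono2) (auto simp: P_def pint_power_mult_geg_nonneg gcoef_nonneg)
    also have "\<dots> \<le> zint d (\<lambda>x. B * poly P x)"
      unfolding *
    proof (rule zint_mono)
      fix x :: real assume x: "x \<in> {-1..1}"
      then have "0 \<le> poly P x" by (simp add: P_def poly_power)
      then show "F x * poly P x \<le> B * poly P x" using assms(3)[OF x] by (intro mult_right_mono) auto
    qed (auto intro!: continuous_intros cont)
    also have "\<dots> = B * pint d P" by (simp add: zint_cmult pint_def)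
    finally have "(\<Sum>k<N. pint d (P * geg k d) * gcoef k d F) / pint d P \<le> B"
      using pint_power_pos[OF assms(2), of m] by (simp add: P_def pos_divide_le_eq)
    then show ?thesis by (simp add: P_def sum_divide_distrib)
  qed
  then show "\<exists>N'. \<forall>m\<ge>N'. (\<Sum>k<N. ?r k m * gcoef k d F) \<le> B" by blast
qed

lemma uniform_limit_geg_series:
  assumes "d > 0" "summable (\<lambda>k. \<bar>c k\<bar>)"
  shows "uniform_limit {-1..1} (\<lambda>n x. \<Sum>k<n. c k * poly (geg k d) x) (\<lambda>x. \<Sum>k. c k * poly (geg k d) x) sequentially"
proof (rule Weierstrass_m_test[OF _ assms(2)])
  fix n :: nat and x :: real assume "x \<in> {-1..1}"
  then have "\<bar>c n\<bar> * \<bar>poly (geg n d) x\<bar> \<le> \<bar>c n\<bar> * 1"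
    using assms(1) by (intro mult_left_mono geg_bound) auto
  then show "norm (c n * poly (geg n d) x) \<le> \<bar>c n\<bar>" by (simp add: abs_mult)
qed

text \<open>The difference \<open>D\<close> of \<open>F\<close> and its series is orthogonal to
  every Gegenbauer polynomial, hence to every polynomial, hence by Weierstrass approximation to
  itself. Then \<open>zint_eq_0D\<close> applies at interior points.\<close>

theorem gegenbauer_expansion:
  assumes F: "continuous_on {-1..1} F" and d: "d > 0"
    and sum: "summable (\<lambda>k. \<bar>gcoef k d F\<bar>)" and x: "x \<in> {-1<..<1}"
  shows "F x = (\<Sum>k. gcoef k d F * poly (geg k d) x)"
proof -
  define G where "G y = (\<Sum>k. gcoef k d F * poly (geg k d) y)" for y
  define S where "S n y = (\<Sum>k<n. gcoef k d F * poly (geg k d) y)" for n y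
  define \<kappa> where "\<kappa> = zint d (\<lambda>x. 1)"
  have \<kappa>: "0 < \<kappa>" unfolding \<kappa>_def by (rule zint_one_pos)
  have lim: "uniform_limit {-1..1} S G sequentially"
    unfolding S_def G_def by (rule uniform_limit_geg_series[OF d sum])
  have cont_S: "continuous_on {-1..1} (S n)" for n unfolding S_def by (intro continuous_intros)
  have cont_G: "continuous_on {-1..1} G"
    by (rule uniform_limit_theorem[OF _ lim]) (auto simp: cont_S)
  define D where "D y = F y - G y" for y
  have cont_D: "continuous_on {-1..1} D" unfolding D_def by (intro continuous_intros F cont_G)
  have D_geg: "zint d (\<lambda>y. D y * poly (geg j d) y) = 0" for j
  proof -
    have "(\<lambda>n. zint d (\<lambda>y. S n y * poly (geg j d) y)) \<longlonglongrightarrow> zint d (\<lambda>y. G y * poly (geg j d) y)"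
    proof (rule LIMSEQ_I)
      fix r :: real assume "0 < r"
      then have "0 < r / (2 * \<kappa>)" using \<kappa> by simp
      from uniform_limitD[OF lim this] obtain M where
        M: "\<And>n y. n \<ge> M \<Longrightarrow> y \<in> {-1..1} \<Longrightarrow> dist (S n y) (G y) < r / (2 * \<kappa>)"
        unfolding eventually_sequentially by blast
      have "\<bar>zint d (\<lambda>y. S n y * poly (geg j d) y) - zint d (\<lambda>y. G y * poly (geg j d) y)\<bar> \<le> r / (2 * \<kappa>) * \<kappa>"
        if "n \<ge> M" for n
        unfolding \<kappa>_def
      proof (rule zint_diff_bound)
        fix y :: real assume y: "y \<in> {-1..1}"
        have "\<bar>S n y - G y\<bar> * \<bar>poly (geg j d) y\<bar> \<le> r / (2 * \<kappa>) * 1"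
          using M[OF that y] geg_bound[OF y d, of j] \<open>0 < r / (2 * \<kappa>)\<close>
          by (intro mult_mono) (auto simp: dist_real_def)
        then show "\<bar>S n y * poly (geg j d) y - G y * poly (geg j d) y\<bar> \<le> r / (2 * zint d (\<lambda>x. 1))"
          by (simp add: \<kappa>_def abs_mult flip: left_diff_distrib)
      qed (auto intro!: continuous_intros cont_S cont_G)
      then show "\<exists>M. \<forall>n\<ge>M. norm (zint d (\<lambda>y. S n y * poly (geg j d) y) - zint d (\<lambda>y. G y * poly (geg j d) y)) < r"
        using \<open>0 < r\<close> \<kappa> by (intro exI[of _ M]) fastforce
    qed
    moreover have "zint d (\<lambda>y. S n y * poly (geg j d) y) = zint d (\<lambda>y. F y * poly (geg j d) y)" if "n > j" for n
    proof -
      have "zint d (\<lambda>y. S n y * poly (geg j d) y)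
          = zint d (\<lambda>y. \<Sum>k<n. gcoef k d F * (poly (geg k d) y * poly (geg j d) y))"
        by (simp add: S_def sum_distrib_right mult.assoc)
      also have "\<dots> = (\<Sum>k<n. gcoef k d F * zint d (\<lambda>y. poly (geg k d) y * poly (geg j d) y))"
        by (subst zint_sum) (auto simp: zint_cmult intro!: continuous_intros)
      also have "\<dots> = (\<Sum>k<n. if k = j then gcoef j d F * geg_norm j d else 0)"
        using pint_geg_geg[OF d, of _ j] by (intro sum.cong) (auto simp: pint_def)
      finally show ?thesis using that geg_norm_pos[OF d, of j] by (simp add: gcoef_def)
    qed
    then have "\<forall>\<^sub>F n in sequentially. zint d (\<lambda>y. S n y * poly (geg j d) y) = zint d (\<lambda>y. F y * poly (geg j d) y)"
      by (rule eventually_mono[OF eventually_gt_at_top[of j]])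
    then have "(\<lambda>n. zint d (\<lambda>y. S n y * poly (geg j d) y)) \<longlonglongrightarrow> zint d (\<lambda>y. F y * poly (geg j d) y)"
      by (rule tendsto_eventually)
    ultimately have "zint d (\<lambda>y. F y * poly (geg j d) y) = zint d (\<lambda>y. G y * poly (geg j d) y)"
      using LIMSEQ_unique by blast
    then show ?thesis
      unfolding D_def left_diff_distrib by (subst zint_diff) (auto intro!: continuous_intros F cont_G)
  qed
  have D_poly: "zint d (\<lambda>y. D y * poly p y) = 0" for p
  proof -
    define c where "c k = pint d (p * geg k d) / geg_norm k d" for k
    have "zint d (\<lambda>y. D y * poly p y) = zint d (\<lambda>y. \<Sum>k\<le>degree p. c k * (D y * poly (geg k d) y))"
      unfolding c_def
      by (subst poly_geg_expansion[OF d order.refl]) (simp add: poly_sum sum_distrib_left mult_ac)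
    also have "\<dots> = (\<Sum>k\<le>degree p. c k * zint d (\<lambda>y. D y * poly (geg k d) y))"
      by (subst zint_sum) (auto simp only: zint_cmult finite_atMost intro!: continuous_intros cont_D)
    finally show ?thesis by (simp add: D_geg)
  qed
  have "bounded (D ` {-1..1})"
    by (intro compact_imp_bounded compact_continuous_image cont_D) auto
  then obtain B where "\<forall>y\<in>D ` {-1..1}. norm y \<le> B" by (auto simp: bounded_iff)
  then have B: "\<bar>D y\<bar> \<le> B" if "y \<in> {-1..1}" for y using that by auto
  have "0 \<le> B" using B[of 0] by auto
  have "\<bar>zint d (\<lambda>y. D y * D y)\<bar> \<le> \<epsilon> * (B * \<kappa>)" if \<epsilon>: "0 < \<epsilon>" for \<epsilon>
  proof -
    obtain p where p: "\<And>y. y \<in> {-1..1} \<Longrightarrow> \<bar>D y - poly p y\<bar> \<le> \<epsilon>"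
      using poly_approximation[OF cont_D \<epsilon>] by blast
    have "\<bar>zint d (\<lambda>y. D y * D y) - zint d (\<lambda>y. D y * poly p y)\<bar> \<le> (B * \<epsilon>) * \<kappa>"
      unfolding \<kappa>_def
    proof (rule zint_diff_bound)
      fix y :: real assume y: "y \<in> {-1..1}"
      have "\<bar>D y\<bar> * \<bar>D y - poly p y\<bar> \<le> B * \<epsilon>"
        using p[OF y] B[OF y] \<open>0 \<le> B\<close> by (intro mult_mono) auto
      then show "\<bar>D y * D y - D y * poly p y\<bar> \<le> B * \<epsilon>" by (simp add: abs_mult flip: right_diff_distrib)
    qed (auto intro!: continuous_intros cont_D)
    then show ?thesis by (simp add: D_poly mult_ac)
  qed
  then have "\<bar>zint d (\<lambda>y. D y * D y)\<bar> \<le> 0"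
    by (rule nonpos_if_le_mult)
  moreover obtain e where "d = Suc e" using d by (cases d) auto
  ultimately have "D x * D x = 0"
    using x by (intro zint_eq_0D[of "\<lambda>y. D y * D y" e]) (auto intro!: continuous_intros cont_D)
  then show ?thesis by (simp add: D_def G_def)
qed

subsection \<open>Derivatives of Gegenbauer polynomials\<close>

lemma poly_ext: "(\<And>x. poly p x = poly q x) \<Longrightarrow> p = q" for p q :: "real poly"
  using poly_eq_poly_eq_iff[of p q] by blast

text \<open>The Leibniz rule stops after three terms because the weight is quadratic. For
  \<open>n = 0\<close> the truncated \<open>n - 1\<close> is harmless, its coefficient being
  zero.\<close>

lemma pderiv_power_mult_weight:
  fixes q :: "real poly"
  shows "(pderiv ^^ n) ([:1, 0, -1:] * pderiv q) = [:1, 0, -1:] * (pderiv ^^ Suc n) q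
    - smult (2 * real n) ([:0, 1:] * (pderiv ^^ n) q) - smult (real n * (real n - 1)) ((pderiv ^^ (n - 1)) q)"
proof (induction n)
  case (Suc n)
  have "smult (real n * (real n - 1)) (pderiv ((pderiv ^^ (n - 1)) q)) = smult (real n * (real n - 1)) ((pderiv ^^ n) q)"
    by (cases n) simp_all
  then have *: "real n * ((real n - 1) * poly (pderiv ((pderiv ^^ (n - 1)) q)) x)
      = real n * ((real n - 1) * poly ((pderiv ^^ n) q) x)" for x
    by (metis poly_smult mult.assoc)
  show ?case
  proof (rule poly_ext)
    fix x
    show "poly ((pderiv ^^ Suc n) ([:1, 0, -1:] * pderiv q)) x = poly ([:1, 0, -1:] * (pderiv ^^ Suc (Suc n)) q
      - smult (2 * real (Suc n)) ([:0, 1:] * (pderiv ^^ Suc n) q)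
      - smult (real (Suc n) * (real (Suc n) - 1)) ((pderiv ^^ (Suc n - 1)) q)) x"
      using *[of x] unfolding funpow.simps o_apply Suc.IH
      by (simp add: pderiv_diff pderiv_add pderiv_minus pderiv_smult pderiv_mult pderiv_pCons algebra_simps)
  qed
qed simp

lemma pderiv_power_mult_X:
  fixes q :: "real poly"
  shows "(pderiv ^^ n) ([:0, 1:] * q) = [:0, 1:] * (pderiv ^^ n) q + smult (real n) ((pderiv ^^ (n - 1)) q)"
proof (induction n)
  case (Suc n)
  have "smult (real n) (pderiv ((pderiv ^^ (n - 1)) q)) = smult (real n) ((pderiv ^^ n) q)"
    by (cases n) simp_all
  then have *: "real n * poly (pderiv ((pderiv ^^ (n - 1)) q)) x = real n * poly ((pderiv ^^ n) q) x" for x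
    by (metis poly_smult)
  show ?case
  proof (rule poly_ext)
    fix x
    show "poly ((pderiv ^^ Suc n) ([:0, 1:] * q)) x
        = poly ([:0, 1:] * (pderiv ^^ Suc n) q + smult (real (Suc n)) ((pderiv ^^ (Suc n - 1)) q)) x"
      using *[of x] unfolding funpow.simps o_apply Suc.IH
      by (simp add: pderiv_add pderiv_smult pderiv_mult pderiv_pCons algebra_simps)
  qed
qed simp

lemma pderiv_power_diff_smult:
  fixes p q :: "real poly"
  shows "(pderiv ^^ n) (smult c (p - q)) = smult c ((pderiv ^^ n) p - (pderiv ^^ n) q)"
  by (induction n) (simp_all add: pderiv_smult pderiv_diff)

text \<open>
  The defining recursion, read as
  \<open>(1 - x\<^sup>2) c' = d (x c - b)\<close> with \<open>c = geg k (d + 2)\<close> and \<open>b = geg (Suc k) d\<close>, trades one derivative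
  for two dimensions.
\<close>

lemma geg_deriv_bound:
  assumes "0 \<le> \<rho>" "\<rho> < 1" "2 * n + 1 \<le> d"
  shows "\<exists>C. \<forall>k x. \<bar>x\<bar> \<le> \<rho> \<longrightarrow> \<bar>poly ((pderiv ^^ n) (geg k d)) x\<bar> \<le> C"
  using assms(3)
proof (induction n arbitrary: d rule: less_induct)
  case (less m)
  show ?case
  proof (cases m)
    case 0
    then show ?thesis using geg_bound[of _ d] less.prems assms(1,2)
      by (intro exI[of _ 1]) (auto simp: abs_le_iff)
  next
    case (Suc n)
    define e where "e = d - 2"
    \<comment> \<open>One order less for two dimensions less keeps the hypothesis:
      \<open>2 * Suc n + 1 \<le> d\<close> is \<open>2 * n + 1 \<le> e\<close>.\<close>
    have d: "d = e + 2" and e: "2 * n + 1 \<le> e" using Suc less.prems by (simp_all add: e_def)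
    obtain C1 where C1: "\<And>k x. \<bar>x\<bar> \<le> \<rho> \<Longrightarrow> \<bar>poly ((pderiv ^^ n) (geg k d)) x\<bar> \<le> C1"
      using less.IH[of n d] Suc less.prems by auto
    obtain C2 where C2: "\<And>k x. \<bar>x\<bar> \<le> \<rho> \<Longrightarrow> \<bar>poly ((pderiv ^^ (n - 1)) (geg k d)) x\<bar> \<le> C2"
    proof -
      have "n - 1 < m" "2 * (n - 1) + 1 \<le> d" using Suc less.prems by simp_all
      from less.IH[OF this] show ?thesis using that by blast
    qed
    obtain C3 where C3: "\<And>k x. \<bar>x\<bar> \<le> \<rho> \<Longrightarrow> \<bar>poly ((pderiv ^^ n) (geg k e)) x\<bar> \<le> C3"
      using less.IH[of n e] Suc e by auto
    define C where "C = 2 * real n * C1 + \<bar>real n * (real n - 1)\<bar> * C2 + real e * (C1 + real n * C2 + C3)"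
    have "\<bar>poly ((pderiv ^^ m) (geg k d)) x\<bar> \<le> C / (1 - \<rho>\<^sup>2)" if x: "\<bar>x\<bar> \<le> \<rho>" for k x
    proof -
      let ?D = "\<lambda>j. poly ((pderiv ^^ j) (geg k d)) x"
      have "[:1, 0, -1:] * pderiv (geg k d) = smult (real e) ([:0, 1:] * geg k d - geg (Suc k) e)"
        using e by (simp add: geg.simps(2) d)
      from arg_cong[OF this, of "\<lambda>p. poly ((pderiv ^^ n) p) x"]
      have eq: "(1 - x * x) * ?D m = 2 * real n * (x * ?D n) + real n * (real n - 1) * ?D (n - 1)
          + real e * (x * ?D n + real n * ?D (n - 1) - poly ((pderiv ^^ n) (geg (Suc k) e)) x)"
        unfolding pderiv_power_mult_weight pderiv_power_diff_smult pderiv_power_mult_X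
        by (simp add: Suc algebra_simps)
      have "\<bar>x\<bar> \<le> 1" using x assms by simp
      then have xD: "\<bar>x * ?D n\<bar> \<le> C1"
        using C1[OF x, of k] mult_mono[of "\<bar>x\<bar>" 1 "\<bar>?D n\<bar>" C1] by (simp add: abs_mult)
      have "\<bar>(1 - x * x) * ?D m\<bar> \<le> \<bar>2 * real n * (x * ?D n)\<bar> + \<bar>real n * (real n - 1) * ?D (n - 1)\<bar>
          + \<bar>real e * (x * ?D n + real n * ?D (n - 1) - poly ((pderiv ^^ n) (geg (Suc k) e)) x)\<bar>"
        unfolding eq by linarith
      also have "\<dots> \<le> C"
        unfolding C_def abs_mult
      proof (intro add_mono mult_mono)
        have "\<bar>real n * ?D (n - 1)\<bar> \<le> real n * C2"
          using C2[OF x, of k] by (simp add: abs_mult mult_left_mono)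
        then show "\<bar>x * ?D n + real n * ?D (n - 1) - poly ((pderiv ^^ n) (geg (Suc k) e)) x\<bar> \<le> C1 + real n * C2 + C3"
          using xD C3[OF x, of "Suc k"] by linarith
      qed (use C2[OF x] xD in \<open>auto simp: abs_mult\<close>)
      finally have "(1 - x * x) * \<bar>?D m\<bar> \<le> C"
        using \<open>\<bar>x\<bar> \<le> 1\<close> abs_square_le_1[of x] by (simp add: abs_mult power2_eq_square)
      moreover have "(1 - \<rho>\<^sup>2) * \<bar>?D m\<bar> \<le> (1 - x * x) * \<bar>?D m\<bar>"
        using x power_mono[of "\<bar>x\<bar>" \<rho> 2] by (intro mult_right_mono) (auto simp: power2_eq_square)
      moreover have "0 < 1 - \<rho>\<^sup>2" using assms(1,2) by (simp add: abs_square_less_1)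
      ultimately show ?thesis by (simp add: pos_le_divide_eq mult.commute)
    qed
    then show ?thesis by blast
  qed
qed

subsection \<open>Positive definite functions on the product of a sphere and a group\<close>

lemma pd_sphere_group_finite:
  fixes f :: "real \<times> 'g::topological_group_add \<Rightarrow> complex" and \<xi> :: "'i \<Rightarrow> real ^ 'n::finite"
  assumes "f \<in> pd_sphere_group TYPE('n)" "finite I" "\<And>i. i \<in> I \<Longrightarrow> \<xi> i \<in> sphere 0 1"
  shows "(\<Sum>i\<in>I. \<Sum>j\<in>I. f (\<xi> i \<bullet> \<xi> j, - u i + u j) * a i * cnj (a j)) \<in> \<real>\<^sub>\<ge>\<^sub>0"
proof (cases "I = {}")
  case False
  obtain h where h: "bij_betw h {1..card I} I"
    using ex_bij_betw_nat_finite_1[OF assms(2)] by blast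
  have hI: "h i \<in> I" if "i \<in> {1..card I}" for i using bij_betwE[OF h] that by blast
  have "\<forall>(m::nat) (\<xi> :: nat \<Rightarrow> real ^ 'n) (u :: nat \<Rightarrow> 'g) (a :: nat \<Rightarrow> complex).
      m \<ge> 1 \<longrightarrow> (\<forall>k\<in>{1..m}. \<xi> k \<in> sphere 0 1) \<longrightarrow>
      (\<Sum>k=1..m. \<Sum>l=1..m. f (\<xi> k \<bullet> \<xi> l, - u k + u l) * a k * cnj (a l)) \<in> \<real>\<^sub>\<ge>\<^sub>0"
    using assms(1) unfolding pd_sphere_group_def by simp
  from this[rule_format, of "card I" "\<lambda>i. \<xi> (h i)" "\<lambda>i. u (h i)" "\<lambda>i. a (h i)"]
  have "(\<Sum>i=1..card I. \<Sum>j=1..card I. f (\<xi> (h i) \<bullet> \<xi> (h j), - u (h i) + u (h j)) * a (h i) * cnj (a (h j))) \<in> \<real>\<^sub>\<ge>\<^sub>0"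
    using False assms(2,3) hI by (simp add: Suc_le_eq card_gt_0_iff)
  also have "(\<Sum>i=1..card I. \<Sum>j=1..card I. f (\<xi> (h i) \<bullet> \<xi> (h j), - u (h i) + u (h j)) * a (h i) * cnj (a (h j)))
      = (\<Sum>i=1..card I. \<Sum>j\<in>I. f (\<xi> (h i) \<bullet> \<xi> j, - u (h i) + u j) * a (h i) * cnj (a j))"
    by (rule sum.cong[OF refl]) (rule sum.reindex_bij_betw[OF h])
  also have "\<dots> = (\<Sum>i\<in>I. \<Sum>j\<in>I. f (\<xi> i \<bullet> \<xi> j, - u i + u j) * a i * cnj (a j))"
    by (rule sum.reindex_bij_betw[OF h])
  finally show ?thesis .
qed simp

lemma pd_sphere_group_continuous:
  assumes "f \<in> pd_sphere_group TYPE('n::finite)"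
  shows "continuous_on ({-1..1} \<times> UNIV) f" "continuous_on {-1..1} (\<lambda>x. f (x, u))"
proof -
  show *: "continuous_on ({-1..1} \<times> UNIV) f" using assms by (simp add: pd_sphere_group_def)
  show "continuous_on {-1..1} (\<lambda>x. f (x, u))"
    by (rule continuous_on_compose2[OF *]) (auto intro!: continuous_intros)
qed

text \<open>
  Testing positive definiteness on the points \<open>(\<xi>\<^sub>i, 0)\<close>, \<open>(\<xi>\<^sub>i, u)\<close> with weights \<open>b\<^sub>i\<close>, \<open>b\<^sub>i z\<close>
  eliminates the group.
\<close>

lemma pd_sphere_group_polarize:
  fixes f :: "real \<times> 'g::topological_group_add \<Rightarrow> complex" and u :: 'g
  assumes f: "f \<in> pd_sphere_group TYPE('n::finite)" and card: "CARD('n) = d + 1" and z: "z * cnj z = 1"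
  defines "\<Phi> \<equiv> \<lambda>x. 2 * f (x, 0) + cnj z * f (x, u) + z * f (x, - u)"
  shows "psd d (\<lambda>x. Re (\<Phi> x))" "psd d (\<lambda>x. Im (\<Phi> x))" "psd d (\<lambda>x. - Im (\<Phi> x))"
proof -
  obtain h :: "nat \<Rightarrow> 'n" where h: "bij_betw h {..d} UNIV"
    using ex_bij_betw_nat_finite[of "UNIV :: 'n set"] card by (auto simp: atLeast0LessThan lessThan_Suc_atMost)
  have cont: "continuous_on {-1..1} \<Phi>"
    unfolding \<Phi>_def by (intro continuous_intros pd_sphere_group_continuous(2)[OF f])
  have main: "(\<Sum>i<m. \<Sum>j<m. complex_of_real (b i * b j) * \<Phi> (\<Sum>t\<le>d. \<xi> i t * \<xi> j t)) \<in> \<real>\<^sub>\<ge>\<^sub>0"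
    if \<xi>: "\<forall>i<m. (\<Sum>t\<le>d. (\<xi> i t)\<^sup>2) = 1" for m :: nat and \<xi> :: "nat \<Rightarrow> nat \<Rightarrow> real" and b
  proof -
    define v :: "nat \<Rightarrow> real ^ 'n" where "v i = (\<chi> c. \<xi> i (the_inv_into {..d} h c))" for i
    have v: "v i \<bullet> v j = (\<Sum>t\<le>d. \<xi> i t * \<xi> j t)" for i j
    proof -
      have "v i \<bullet> v j = (\<Sum>c\<in>UNIV. \<xi> i (the_inv_into {..d} h c) * \<xi> j (the_inv_into {..d} h c))"
        by (simp add: inner_vec_def v_def)
      also have "\<dots> = (\<Sum>t\<le>d. \<xi> i (the_inv_into {..d} h (h t)) * \<xi> j (the_inv_into {..d} h (h t)))"
        by (rule sum.reindex_bij_betw[OF h, symmetric])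
      also have "\<dots> = (\<Sum>t\<le>d. \<xi> i t * \<xi> j t)"
        using h by (intro sum.cong) (auto simp: bij_betw_def the_inv_into_f_f)
      finally show ?thesis .
    qed
    have "(\<Sum>p\<in>{..<m} \<times> UNIV. \<Sum>q\<in>{..<m} \<times> UNIV. f (v (fst p) \<bullet> v (fst q), - (if snd p then u else 0) + (if snd q then u else 0))
        * (complex_of_real (b (fst p)) * (if snd p then z else 1)) * cnj (complex_of_real (b (fst q)) * (if snd q then z else 1))) \<in> \<real>\<^sub>\<ge>\<^sub>0"
    proof (rule pd_sphere_group_finite[OF f])
      fix p :: "nat \<times> bool" assume "p \<in> {..<m} \<times> UNIV"
      then have "v (fst p) \<bullet> v (fst p) = 1" using \<xi> v by (auto simp: power2_eq_square)
      then show "v (fst p) \<in> sphere 0 1" by (simp add: norm_eq_1)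
    qed simp
    also have "(\<Sum>p\<in>{..<m} \<times> UNIV. \<Sum>q\<in>{..<m} \<times> UNIV. f (v (fst p) \<bullet> v (fst q), - (if snd p then u else 0) + (if snd q then u else 0))
        * (complex_of_real (b (fst p)) * (if snd p then z else 1)) * cnj (complex_of_real (b (fst q)) * (if snd q then z else 1)))
      = (\<Sum>i<m. \<Sum>j<m. \<Sum>s\<in>UNIV. \<Sum>t\<in>UNIV. f (v i \<bullet> v j, - (if s then u else 0) + (if t then u else 0))
        * (complex_of_real (b i) * (if s then z else 1)) * cnj (complex_of_real (b j) * (if t then z else 1)))"
      unfolding sum.cartesian_product' fst_conv snd_conv
      by (intro sum.cong refl) (rule sum.swap)
    also have "\<dots> = (\<Sum>i<m. \<Sum>j<m. complex_of_real (b i * b j) * \<Phi> (\<Sum>t\<le>d. \<xi> i t * \<xi> j t))"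
    proof (intro sum.cong refl)
      fix i j
      let ?x = "\<Sum>t\<le>d. \<xi> i t * \<xi> j t"
      have "(\<Sum>s\<in>UNIV. \<Sum>t\<in>UNIV. f (v i \<bullet> v j, - (if s then u else 0) + (if t then u else 0))
        * (complex_of_real (b i) * (if s then z else 1)) * cnj (complex_of_real (b j) * (if t then z else 1)))
        = complex_of_real (b i * b j) * (f (?x, 0) + cnj z * f (?x, u) + z * f (?x, - u) + z * cnj z * f (?x, 0))"
        by (simp add: UNIV_bool v algebra_simps)
      \<comment> \<open>As \<open>z\<close> has modulus one, the two diagonal terms merge into
        \<open>2 * f (x, 0)\<close>.\<close>
      then show "(\<Sum>s\<in>UNIV. \<Sum>t\<in>UNIV. f (v i \<bullet> v j, - (if s then u else 0) + (if t then u else 0))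
        * (complex_of_real (b i) * (if s then z else 1)) * cnj (complex_of_real (b j) * (if t then z else 1)))
        = complex_of_real (b i * b j) * \<Phi> ?x"
        unfolding z \<Phi>_def by (simp add: algebra_simps)
    qed
    finally show ?thesis .
  qed
  \<comment> \<open>The complex form is real, so its imaginary part vanishes. Hence both
    \<open>Im\<close> and its negative are positive definite, which later forces the coefficients of
    the imaginary part to be zero.\<close>
  have ReIm: "0 \<le> (\<Sum>i<m. \<Sum>j<m. b i * b j * Re (\<Phi> (\<Sum>t\<le>d. \<xi> i t * \<xi> j t)))"
    "(\<Sum>i<m. \<Sum>j<m. b i * b j * Im (\<Phi> (\<Sum>t\<le>d. \<xi> i t * \<xi> j t))) = 0"
    if "\<forall>i<m. (\<Sum>t\<le>d. (\<xi> i t)\<^sup>2) = 1" for m :: nat and \<xi> :: "nat \<Rightarrow> nat \<Rightarrow> real" and b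
    using main[OF that, of b] by (simp_all add: complex_nonneg_Reals_iff)
  show "psd d (\<lambda>x. Re (\<Phi> x))" "psd d (\<lambda>x. Im (\<Phi> x))" "psd d (\<lambda>x. - Im (\<Phi> x))"
    unfolding psd_def using ReIm cont by (auto simp: sum_negf intro!: continuous_intros)
qed

text \<open>Coefficientwise form of the fact that a positive definite function on a group is
  dominated by its value at the neutral element. \<open>R k 0\<close> controls real and imaginary
  parts alike, independently of \<open>u\<close>.\<close>

lemma gcoef_group_bound:
  fixes f :: "real \<times> 'g::topological_group_add \<Rightarrow> complex"
  assumes f: "f \<in> pd_sphere_group TYPE('n::finite)" and card: "CARD('n) = d + 1" and d: "d > 0"
  defines "R \<equiv> \<lambda>k u. gcoef k d (\<lambda>x. Re (f (x, u)))" and "J \<equiv> \<lambda>k u. gcoef k d (\<lambda>x. Im (f (x, u)))"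
  shows "\<bar>R k u\<bar> \<le> R k 0" "\<bar>J k u\<bar> \<le> R k 0"
proof -
  have cont: "continuous_on {-1..1} (\<lambda>x. Re (f (x, u)))" "continuous_on {-1..1} (\<lambda>x. Im (f (x, u)))" for u
    by (intro continuous_intros pd_sphere_group_continuous(2)[OF f])+
  have *: "0 \<le> 2 * R k 0 + (a * R k u + b * J k u) + (a * R k (-u) - b * J k (-u))"
    "0 = 2 * J k 0 + (a * J k u - b * R k u) + (a * J k (-u) + b * R k (-u))"
    if ab: "a * a + b * b = 1" for a b
  proof -
    have z: "Complex a b * cnj (Complex a b) = 1" using ab by (simp add: complex_eq_iff)
    let ?\<Phi> = "\<lambda>x. 2 * f (x, 0) + cnj (Complex a b) * f (x, u) + Complex a b * f (x, -u)"
    have "(\<lambda>x. Re (?\<Phi> x)) = (\<lambda>x. 2 * Re (f (x, 0)) + (a * Re (f (x, u)) + b * Im (f (x, u)))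
        + (a * Re (f (x, -u)) + (-b) * Im (f (x, -u))))"
      by (simp add: fun_eq_iff)
    then have Re: "gcoef k d (\<lambda>x. Re (?\<Phi> x)) = 2 * R k 0 + (a * R k u + b * J k u) + (a * R k (-u) + (-b) * J k (-u))"
      unfolding R_def J_def by (simp only: gcoef_add gcoef_cmult cont continuous_intros)
    have "(\<lambda>x. Im (?\<Phi> x)) = (\<lambda>x. 2 * Im (f (x, 0)) + (a * Im (f (x, u)) + (-b) * Re (f (x, u)))
        + (a * Im (f (x, -u)) + b * Re (f (x, -u))))"
      by (simp add: fun_eq_iff)
    then have Im: "gcoef k d (\<lambda>x. Im (?\<Phi> x)) = 2 * J k 0 + (a * J k u + (-b) * R k u) + (a * J k (-u) + b * R k (-u))"
      unfolding R_def J_def by (simp only: gcoef_add gcoef_cmult cont continuous_intros)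
    from gcoef_cmult[of k d "-1" "\<lambda>x. Im (?\<Phi> x)"]
    have "gcoef k d (\<lambda>x. - Im (?\<Phi> x)) = - gcoef k d (\<lambda>x. Im (?\<Phi> x))" by simp
    with gcoef_nonneg[OF pd_sphere_group_polarize(1)[OF f card z] d, of k u]
      gcoef_nonneg[OF pd_sphere_group_polarize(2)[OF f card z] d, of k u]
      gcoef_nonneg[OF pd_sphere_group_polarize(3)[OF f card z] d, of k u]
    show "0 \<le> 2 * R k 0 + (a * R k u + b * J k u) + (a * R k (-u) - b * J k (-u))"
      "0 = 2 * J k 0 + (a * J k u - b * R k u) + (a * J k (-u) + b * R k (-u))"
      unfolding Re Im by simp_all
  qed
  \<comment> \<open>The values \<open>1, -1, i, -i\<close> of \<open>z\<close> suffice. The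
    equations give \<open>J k 0 = 0\<close>, \<open>R k (-u) = R k u\<close> and
    \<open>J k (-u) = - J k u\<close>; the inequalities then give both bounds.\<close>
  show "\<bar>R k u\<bar> \<le> R k 0" "\<bar>J k u\<bar> \<le> R k 0"
    using *[of 1 0] *[of "-1" 0] *[of 0 1] *[of 0 "-1"] by simp_all
qed

lemma summable_gcoef_group:
  fixes f :: "real \<times> 'g::topological_group_add \<Rightarrow> complex"
  assumes f: "f \<in> pd_sphere_group TYPE('n::finite)" and card: "CARD('n) = d + 1" and d: "d > 0"
  shows "summable (\<lambda>k. gcoef k d (\<lambda>x. Re (f (x, 0))))"
proof -
  let ?F = "\<lambda>x. Re (f (x, 0))"
  have cont: "continuous_on {-1..1} ?F"
    by (intro continuous_intros pd_sphere_group_continuous(2)[OF f])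
  \<comment> \<open>For \<open>u = 0\<close> and \<open>z = 1\<close> the polarised function is
    \<open>4 * f (x, 0)\<close>.\<close>
  have "psd d (\<lambda>x. Re (2 * f (x, 0) + cnj 1 * f (x, 0) + 1 * f (x, - 0)))"
    by (rule pd_sphere_group_polarize(1)[OF f card]) simp
  then have psd: "psd d (\<lambda>x. 4 * ?F x)" by simp
  have "bounded ((\<lambda>x. 4 * ?F x) ` {-1..1})"
    by (intro compact_imp_bounded compact_continuous_image continuous_intros cont) auto
  then obtain B where B: "\<forall>y\<in>(\<lambda>x. 4 * ?F x) ` {-1..1}. norm y \<le> B" by (auto simp: bounded_iff)
  have "(\<Sum>k<N. gcoef k d (\<lambda>x. 4 * ?F x)) \<le> B" for N
    by (rule sum_gcoef_le[OF psd d]) (use B in auto)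
  then have "summable (\<lambda>k. gcoef k d (\<lambda>x. 4 * ?F x))"
    by (rule summableI_nonneg_bounded[OF gcoef_nonneg[OF psd d]])
  then have "summable (\<lambda>k. 4 * gcoef k d ?F)" by (simp only: gcoef_cmult)
  then show ?thesis by simp
qed

lemma continuous_gcoef_group:
  fixes f :: "real \<times> 'g::topological_space \<Rightarrow> real"
  assumes "continuous_on ({-1..1} \<times> UNIV) f" "d > 0"
  shows "continuous_on UNIV (\<lambda>u. gcoef k d (\<lambda>x. f (x, u)))"
proof -
  have "continuous_on (UNIV \<times> {-1..1}) (\<lambda>p. (snd p, fst p) :: real \<times> 'g)" by (intro continuous_intros)
  then have "continuous_on (UNIV \<times> {-1..1}) (\<lambda>p. f (snd p, fst p))"
    by (rule continuous_on_compose2[OF assms(1)]) auto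
  moreover have "continuous_on (UNIV \<times> {-1..1}) (\<lambda>p :: 'g \<times> real. poly (geg k d) (snd p))"
    by (rule continuous_on_compose2[of UNIV "poly (geg k d)"]) (auto intro!: continuous_intros)
  ultimately have "continuous_on (UNIV \<times> {-1..1}) (\<lambda>(u, x). f (x, u) * poly (geg k d) x)"
    unfolding case_prod_beta by (rule continuous_on_mult)
  then have "continuous_on UNIV (\<lambda>u. zint d (\<lambda>x. f (x, u) * poly (geg k d) x))"
    by (rule continuous_on_zint)
  then show ?thesis
    unfolding gcoef_def using geg_norm_pos[OF assms(2), of k] by (intro continuous_on_divide) auto
qed

section \<open>Termwise differentiation and joint continuity of the expansion\<close>

definition geg_series :: "nat \<Rightarrow> nat \<Rightarrow> (nat \<Rightarrow> real) \<Rightarrow> real \<Rightarrow> real" where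
  "geg_series d j c x = (\<Sum>k. c k * poly ((pderiv ^^ j) (geg k d)) x)"

text \<open>Weierstrass test with majorant \<open>M k * C\<close>. The parameter set
  \<open>V\<close> will be the whole group for joint continuity and a single point for
  differentiation in \<open>x\<close>.\<close>

lemma uniform_limit_geg_deriv_series:
  assumes "0 \<le> \<rho>" "\<rho> < 1" "2 * j + 1 \<le> d" "summable M" "\<And>k v. v \<in> V \<Longrightarrow> \<bar>c v k\<bar> \<le> M k"
  shows "uniform_limit ({-\<rho>..\<rho>} \<times> V) (\<lambda>n (x, v). \<Sum>k<n. c v k * poly ((pderiv ^^ j) (geg k d)) x)
    (\<lambda>(x, v). geg_series d j (c v) x) sequentially"
proof -
  obtain C where C: "\<And>k x. \<bar>x\<bar> \<le> \<rho> \<Longrightarrow> \<bar>poly ((pderiv ^^ j) (geg k d)) x\<bar> \<le> C"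
    using geg_deriv_bound[OF assms(1-3)] by blast
  have "norm (c (snd p) k * poly ((pderiv ^^ j) (geg k d)) (fst p)) \<le> M k * C"
    if "p \<in> {-\<rho>..\<rho>} \<times> V" for p k
    unfolding real_norm_def abs_mult
    using that assms(5)[of "snd p" k] C[of "fst p" k]
    by (intro mult_mono) (auto simp: abs_le_iff intro: order.trans[OF abs_ge_zero])
  then have "uniform_limit ({-\<rho>..\<rho>} \<times> V) (\<lambda>n p. \<Sum>k<n. c (snd p) k * poly ((pderiv ^^ j) (geg k d)) (fst p))
    (\<lambda>p. \<Sum>k. c (snd p) k * poly ((pderiv ^^ j) (geg k d)) (fst p)) sequentially"
    by (rule Weierstrass_m_test) (auto intro: summable_mult2 assms(4))
  then show ?thesis by (simp add: geg_series_def case_prod_unfold)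
qed

lemma geg_series_has_derivative:
  assumes d: "2 * Suc j + 1 \<le> d" and M: "summable M" "\<And>k. \<bar>c k\<bar> \<le> M k" and x: "x \<in> {-1<..<1}"
  shows "(geg_series d j c has_real_derivative geg_series d (Suc j) c x) (at x)"
proof -
  \<comment> \<open>The midpoint between \<open>\<bar>x\<bar>\<close> and \<open>1\<close> makes
    \<open>x\<close> interior to an interval of uniform convergence.\<close>
  define \<rho> where "\<rho> = (1 + \<bar>x\<bar>) / 2"
  have \<rho>: "0 \<le> \<rho>" "\<rho> < 1" "\<bar>x\<bar> < \<rho>" "- \<rho> < x" "x < \<rho>" using x by (auto simp: \<rho>_def abs_if field_simps)
  have unif: "uniform_limit {-\<rho>..\<rho>} (\<lambda>n x. \<Sum>k<n. c k * poly ((pderiv ^^ i) (geg k d)) x) (geg_series d i c) sequentially"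
    if "2 * i + 1 \<le> d" for i
  proof -
    have "uniform_limit ({-\<rho>..\<rho>} \<times> {()}) (\<lambda>n (x, v). \<Sum>k<n. c k * poly ((pderiv ^^ i) (geg k d)) x)
      (\<lambda>(x, v). geg_series d i c x) sequentially"
      using uniform_limit_geg_deriv_series[OF \<rho>(1,2) that M(1), of "{()}" "\<lambda>_. c"] M(2) by simp
    from uniform_limit_compose'[OF this, of "\<lambda>x. (x, ())" "{-\<rho>..\<rho>}"] show ?thesis by simp
  qed
  have "((\<lambda>x. \<Sum>k. c k * poly ((pderiv ^^ j) (geg k d)) x) has_field_derivative
      (\<Sum>k. c k * poly ((pderiv ^^ Suc j) (geg k d)) x)) (at x)"
  proof (rule has_field_derivative_series'(2))
    show "convex {-\<rho>..\<rho>}" by simp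
    show "((\<lambda>x. c k * poly ((pderiv ^^ j) (geg k d)) x) has_field_derivative
        c k * poly ((pderiv ^^ Suc j) (geg k d)) y) (at y within {-\<rho>..\<rho>})" for k y
      using poly_DERIV[of "(pderiv ^^ j) (geg k d)" y]
      by (auto intro!: derivative_eq_intros DERIV_subset[OF poly_DERIV])
    show "uniformly_convergent_on {-\<rho>..\<rho>} (\<lambda>n x. \<Sum>k<n. c k * poly ((pderiv ^^ Suc j) (geg k d)) x)"
      using unif[OF d] uniformly_convergent_on_def by blast
    show "0 \<in> {-\<rho>..\<rho>}" "x \<in> interior {-\<rho>..\<rho>}" using \<rho> by auto
    have "2 * j + 1 \<le> d" using d by simp
    from tendsto_uniform_limitI[OF unif[OF this], of 0] \<rho>(1)
    show "summable (\<lambda>k. c k * poly ((pderiv ^^ j) (geg k d)) 0)"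
      by (auto simp: summable_def sums_def)
  qed
  then show ?thesis by (simp add: geg_series_def[abs_def])
qed

text \<open>Convergence is uniform over the whole group as long as \<open>x\<close> stays in
  \<open>[-\<rho>, \<rho>]\<close> with \<open>\<rho> < 1\<close>; the corresponding open strips
  exhaust the domain.\<close>

lemma continuous_on_geg_series:
  fixes c :: "'g::topological_space \<Rightarrow> nat \<Rightarrow> real"
  assumes d: "2 * j + 1 \<le> d" and M: "summable M" "\<And>k u. \<bar>c u k\<bar> \<le> M k"
    and cont: "\<And>k. continuous_on UNIV (\<lambda>u. c u k)"
  shows "continuous_on ({-1<..<1} \<times> UNIV) (\<lambda>(x, u). geg_series d j (c u) x)"
proof -
  have "continuous_on ({-\<rho><..<\<rho>} \<times> UNIV) (\<lambda>(x, u). geg_series d j (c u) x)" if \<rho>: "\<rho> \<in> {0<..<1}" for \<rho>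
  proof -
    have "continuous_on ({-\<rho>..\<rho>} \<times> UNIV) (\<lambda>(x, u). geg_series d j (c u) x)"
    proof (rule uniform_limit_theorem)
      show "uniform_limit ({-\<rho>..\<rho>} \<times> UNIV) (\<lambda>n (x, u). \<Sum>k<n. c u k * poly ((pderiv ^^ j) (geg k d)) x)
          (\<lambda>(x, u). geg_series d j (c u) x) sequentially"
        by (rule uniform_limit_geg_deriv_series[OF _ _ d M(1)]) (use \<rho> M(2) in auto)
      have "continuous_on ({-\<rho>..\<rho>} \<times> UNIV) (\<lambda>p :: real \<times> 'g. poly p' (fst p))" for p'
        by (rule continuous_on_compose2[of UNIV "poly p'"]) (auto intro!: continuous_intros)
      moreover have "continuous_on ({-\<rho>..\<rho>} \<times> UNIV) (\<lambda>p :: real \<times> 'g. c (snd p) k)" for k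
        by (rule continuous_on_compose2[OF cont]) (auto intro!: continuous_intros)
      ultimately show "\<forall>\<^sub>F n in sequentially. continuous_on ({-\<rho>..\<rho>} \<times> UNIV)
          (\<lambda>(x, u). \<Sum>k<n. c u k * poly ((pderiv ^^ j) (geg k d)) x)"
        unfolding case_prod_beta by (intro always_eventually allI continuous_on_sum continuous_on_mult)
    qed simp
    then show ?thesis by (rule continuous_on_subset) auto
  qed
  then have "continuous_on (\<Union>\<rho>\<in>{0<..<1}. {-\<rho><..<\<rho>} \<times> UNIV) (\<lambda>(x, u). geg_series d j (c u) x)"
    by (intro continuous_on_open_UN open_Times) auto
  moreover have "(\<Union>\<rho>\<in>{0<..<1}. {-\<rho><..<\<rho>} \<times> UNIV) = {-1<..<1::real} \<times> (UNIV :: 'g set)"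
  proof (intro equalityI subsetI)
    fix p :: "real \<times> 'g" assume "p \<in> {-1<..<1} \<times> UNIV"
    then have "(1 + \<bar>fst p\<bar>) / 2 \<in> {0<..<1}" "p \<in> {- ((1 + \<bar>fst p\<bar>) / 2)<..<(1 + \<bar>fst p\<bar>) / 2} \<times> UNIV"
      by (auto simp: abs_if field_simps)
    then show "p \<in> (\<Union>\<rho>\<in>{0<..<1}. {-\<rho><..<\<rho>} \<times> UNIV)" by blast
  qed auto
  ultimately show ?thesis by simp
qed

theorem corollary3p9:
  fixes d n :: nat
    and f :: "real \<times> 'g::topological_group_add \<Rightarrow> complex"
  assumes "locally_compact_space (euclidean :: 'g topology)"
    and "d \<ge> 1"
    and "CARD('n::finite) = d + 1"
    and "f \<in> pd_sphere_group TYPE('n)"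
    and "int n \<le> \<lfloor>(real d - 1) / 2\<rfloor>"
  shows "partial_x_exists n f \<and> continuous_on ({-1<..<1} \<times> UNIV) (partial_x n f)"
proof -
  note f = assms(4) and card = assms(3)
  have d: "d > 0" using assms(2) by simp
  have n: "2 * n + 1 \<le> d" using assms(5) by (simp add: le_floor_iff field_simps)
  define R where "R u k = gcoef k d (\<lambda>x. Re (f (x, u)))" for u k
  define J where "J u k = gcoef k d (\<lambda>x. Im (f (x, u)))" for u k
  have sum: "summable (R 0)" unfolding R_def by (rule summable_gcoef_group[OF f card d])
  have bound: "\<bar>R u k\<bar> \<le> R 0 k" "\<bar>J u k\<bar> \<le> R 0 k" for u k
    unfolding R_def J_def by (rule gcoef_group_bound[OF f card d])+
  have cont: "continuous_on UNIV (\<lambda>u. R u k)" "continuous_on UNIV (\<lambda>u. J u k)" for k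
    unfolding R_def J_def
    by (rule continuous_gcoef_group[OF _ d, of "\<lambda>p. Re (f p)"]
        continuous_gcoef_group[OF _ d, of "\<lambda>p. Im (f p)"];
        intro continuous_intros pd_sphere_group_continuous(1)[OF f])+
  \<comment> \<open>The candidate for the \<open>j\<close>-th derivative, assembled from real and
    imaginary parts because the expansion theory is real.\<close>
  define D where "D j = (\<lambda>(x, u). Complex (geg_series d j (R u) x) (geg_series d j (J u) x))" for j
  have deriv: "((\<lambda>t. D j (t, u)) has_vector_derivative D (Suc j) (x, u)) (at x)"
    if "j < n" "x \<in> {-1<..<1}" for j x u
  proof -
    have "2 * Suc j + 1 \<le> d" using that n by simp
    then show ?thesis
      unfolding has_vector_derivative_complex_iff D_def
      using geg_series_has_derivative[OF _ sum bound(1) that(2)]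
        geg_series_has_derivative[OF _ sum bound(2) that(2)] by simp
  qed
  have D: "partial_x j f (x, u) = D j (x, u)" if "j \<le> n" "x \<in> {-1<..<1}" for j x u
    using that
  proof (induction j arbitrary: x)
    case 0
    have cont_f: "continuous_on {-1..1} (\<lambda>x. Re (f (x, u)))" "continuous_on {-1..1} (\<lambda>x. Im (f (x, u)))"
      by (intro continuous_intros pd_sphere_group_continuous(2)[OF f])+
    have "summable (\<lambda>k. \<bar>R u k\<bar>)" "summable (\<lambda>k. \<bar>J u k\<bar>)"
      by (rule summable_comparison_test'[OF sum]; use bound in simp)+
    then have "Re (f (x, u)) = geg_series d 0 (R u) x" "Im (f (x, u)) = geg_series d 0 (J u) x"
      using gegenbauer_expansion[OF cont_f(1) d _ 0(2)] gegenbauer_expansion[OF cont_f(2) d _ 0(2)]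
      unfolding R_def J_def geg_series_def by simp_all
    then show ?case by (simp add: partial_x_def D_def complex_eq_iff)
  next
    case (Suc j)
    have "((\<lambda>t. partial_x j f (t, u)) has_vector_derivative D (Suc j) (x, u)) (at x)"
      \<comment> \<open>The induction hypothesis identifies \<open>partial_x j f\<close> with
        \<open>D j\<close> on the whole open interval, a neighbourhood of \<open>x\<close>, so the
        derivative at \<open>x\<close> carries over.\<close>
      by (rule has_vector_derivative_transform_within_open[OF deriv[of j x u], of "{-1<..<1}"])
        (use Suc in auto)
    then have "vector_derivative (\<lambda>t. partial_x j f (t, u)) (at x) = D (Suc j) (x, u)"
      by (rule vector_derivative_at)
    then show ?case by (simp add: partial_x_def)
  qed
  have "(\<lambda>t. partial_x j f (t, u)) differentiable (at x)" if "j < n" "x \<in> {-1<..<1}" for j x u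
  proof -
    have "((\<lambda>t. partial_x j f (t, u)) has_vector_derivative D (Suc j) (x, u)) (at x)"
      by (rule has_vector_derivative_transform_within_open[OF deriv[OF that, of u], of "{-1<..<1}"])
        (use that D in auto)
    then show ?thesis by (rule differentiableI_vector)
  qed
  moreover have "continuous_on ({-1<..<1} \<times> UNIV) (partial_x n f)"
  proof -
    have "continuous_on ({-1<..<1} \<times> UNIV) (D n)"
      unfolding D_def case_prod_beta
      using continuous_on_geg_series[OF n sum bound(1) cont(1)] continuous_on_geg_series[OF n sum bound(2) cont(2)]
      unfolding case_prod_beta by (intro continuous_on_Complex)
    then show ?thesis
      by (rule continuous_on_eq) (use D in auto)
  qed
  ultimately show ?thesis unfolding partial_x_exists_def by blast
qed

end
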